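(* Let $d\ge 1$, let $R=\mathbb{Z}[u_1^{\pm1},\dots,u_d^{\pm1}]$, let $A$ be a $k\times k$ matrix over $R$ of maximal rank $k$, and let $M_A=R^k/AR^k$. Let $\Lambda\subset\mathbb{Z}^d$ be a lattice of full rank. Then $$\left|\mathrm{Fix}_{\Lambda}\left(\alpha^{M_A}\right)\right|=\begin{cases}\infty & \text{if } \prod_{\mathbf z\in\Lambda^{\perp}}|\det(A)(\mathbf z)|=0;\\ \prod_{\mathbf z\in\Lambda^{\perp}}|\det(A)(\mathbf z)| & \text{if not.}\end{cases}$$
   Context: For an $R$-module $M$ (with the discrete topology), $X_M=\widehat{M}$ is the compact abelian Pontryagin dual group of $M$, and $\alpha^M$ is the $\mathbb{Z}^d$-action by automorphisms of $X_M$ in which, for $\mathbf{n}=(n_1,\dots,n_d)\in\mathbb{Z}^d$, $\alpha^M_{\mathbf n}$ is the automorphism dual to the automorphism $a\mapsto u^{\mathbf n}a$ of $M$, with $u^{\mathbf n}=u_1^{n_1}\cdots u_d^{n_d}$. For a $\mathbb{Z}^d$-action $\alpha$ on $X$ and a lattice (subgroup) $\Lambda\subset\mathbb{Z}^d$ of full rank (finite index), the set of points of period $\Lambda$ is $\mathrm{Fix}_\Lambda(\alpha)=\{x\in X:\alpha_{\mathbf n}x=x\ \text{for all } \mathbf n\in\Lambda\}$. The annihilator of $\Lambda$ is the finite subgroup $\Lambda^\perp=\{\mathbf z\in(\mathbb{S}^1)^d: z_1^{n_1}\cdots z_d^{n_d}=1 \text{ for all }\mathbf n\in\Lambda\}$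 of $(\mathbb{S}^1)^d$, where $\mathbb{S}^1=\{z\in\mathbb{C}:|z|=1\}$; it has cardinality $|\mathbb{Z}^d/\Lambda|$. $\det(A)(\mathbf z)$ is the value of the Laurent polynomial $\det(A)$ at $\mathbf z$. *)

theory Defs
  imports
    "HOL-Analysis.Analysis"
    "HOL-Algebra.Algebra"
    "HOL-Library.Poly_Mapping"
begin

section \<open>Laurent polynomials\<close>

text \<open>
  The ring \<open>\<int>[u\<^sub>1\<^sup>\<plusminus>\<^sup>1, \<dots>, u\<^sub>d\<^sup>\<plusminus>\<^sup>1]\<close> with \<open>d = CARD('d)\<close>: a Laurent polynomial is the finitely
  supported map sending an exponent vector in \<open>\<int>\<^sup>d\<close> to its coefficient, and the product of
  such maps is the convolution.
\<close>

type_synonym 'd laurent = "(int, 'd) vec \<Rightarrow>\<^sub>0 int"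

definition monomial :: "int ^ 'd \<Rightarrow> 'd laurent" where
  "monomial n = Poly_Mapping.single n 1"

definition monom_val :: "complex ^ 'd \<Rightarrow> int ^ 'd \<Rightarrow> complex" where
  "monom_val z n = (\<Prod>i\<in>UNIV. (z $ i) powi (n $ i))"

definition laurent_val :: "'d::finite laurent \<Rightarrow> complex ^ 'd \<Rightarrow> complex" where
  "laurent_val f z = (\<Sum>n\<in>Poly_Mapping.keys f. of_int (Poly_Mapping.lookup f n) * monom_val z n)"

section \<open>Rank of a matrix\<close>

lemma module_vector_scalar_mult:
  "Modules.module ((*s) :: 'a::comm_ring_1 \<Rightarrow> 'a ^ 'n \<Rightarrow> 'a ^ 'n)"
  by unfold_locales
    (simp_all add: vec_eq_iff vector_scalar_mult_def ring_distribs mult.assoc)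

text \<open>
  The maximal number of linearly independent columns. Over an integral domain this is the rank
  over the field of fractions. The constant \<open>rank\<close> of the library requires entries in
  a field.
\<close>

definition mat_rank :: "'a::comm_ring_1 ^ 'n ^ 'm \<Rightarrow> nat" where
  "mat_rank A = Max {card S |S. S \<subseteq> columns A \<and> \<not> Modules.module.dependent (*s) S}"

section \<open>Modules\<close>

text \<open>The fields \<open>mult\<close> and \<open>one\<close> of the module record play no role for modules.\<close>

definition free_module :: "('a::comm_ring_1, 'a ^ 'k) module" where
  "free_module = \<lparr>carrier = UNIV, mult = undefined, one = undefined,
     ring.zero = 0, add = (+), smult = (*s)\<rparr>"

text \<open>
  The quotient of \<open>M\<close> by a submodule \<open>N\<close>. The union in the scalar multiplication is over equal
  cosets.
\<close>

definition quotient_module :: "('a, 'm) module \<Rightarrow> 'm set \<Rightarrow> ('a, 'm set) module" where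
  "quotient_module M N = \<lparr>carrier = a_rcosets\<^bsub>M\<^esub> N, mult = undefined, one = undefined,
     ring.zero = N, add = set_add M, smult = (\<lambda>r C. \<Union>x\<in>C. N +>\<^bsub>M\<^esub> (r \<odot>\<^bsub>M\<^esub> x))\<rparr>"

definition cokernel_module :: "'a::comm_ring_1 ^ 'k ^ 'k \<Rightarrow> ('a, ('a ^ 'k) set) module" where
  "cokernel_module A = quotient_module free_module (range (\<lambda>x. A *v x))"

section \<open>Pontryagin duals and the dual action\<close>

definition circle_group :: "complex monoid" where
  "circle_group = \<lparr>carrier = {z. cmod z = 1}, mult = (*), one = 1\<rparr>"

text \<open>
  The dual of a discrete abelian group: every homomorphism to the circle is continuous. Characters
  are made extensional so that equality of characters is equality of functions. The (compact)
  topology of the dual is that of pointwise convergence; neither the maps below nor their fixed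
  points depend on it, so it is not part of the record.
\<close>

definition pontryagin_dual :: "('a, 'b) monoid_scheme \<Rightarrow> ('a \<Rightarrow> complex) monoid" where
  "pontryagin_dual G = \<lparr>carrier = hom G circle_group \<inter> extensional (carrier G),
     mult = (\<lambda>\<theta> \<psi>. \<lambda>a\<in>carrier G. \<theta> a * \<psi> a), one = (\<lambda>a\<in>carrier G. 1)\<rparr>"

definition dual_map :: "('a, 'b) monoid_scheme \<Rightarrow> ('a \<Rightarrow> 'a) \<Rightarrow> ('a \<Rightarrow> complex) \<Rightarrow> ('a \<Rightarrow> complex)" where
  "dual_map G \<phi> \<theta> = (\<lambda>a\<in>carrier G. \<theta> (\<phi> a))"

text \<open>The group \<open>X\<^sub>M\<close> and the action \<open>\<alpha>\<^sup>M\<close>.\<close>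

definition dual_space :: "('d::finite laurent, 'm) module \<Rightarrow> ('m \<Rightarrow> complex) monoid" where
  "dual_space M = pontryagin_dual (add_monoid M)"

definition dual_action ::
    "('d::finite laurent, 'm) module \<Rightarrow> int ^ 'd \<Rightarrow> ('m \<Rightarrow> complex) \<Rightarrow> ('m \<Rightarrow> complex)" where
  "dual_action M n = dual_map (add_monoid M) (\<lambda>a. monomial n \<odot>\<^bsub>M\<^esub> a)"

section \<open>Lattices and periodic points\<close>

definition Zd_group :: "(int ^ 'd) monoid" where
  "Zd_group = \<lparr>carrier = UNIV, mult = (+), one = 0\<rparr>"

text \<open>For a subgroup of \<open>\<int>\<^sup>d\<close>, full rank means finite index.\<close>

definition full_lattice :: "(int ^ 'd) set \<Rightarrow> bool" where
  "full_lattice \<Lambda> \<longleftrightarrow> subgroup \<Lambda> Zd_group \<and> finite (rcosets\<^bsub>Zd_group\<^esub> \<Lambda>)"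

definition Fix_points :: "'x set \<Rightarrow> (int ^ 'd \<Rightarrow> 'x \<Rightarrow> 'x) \<Rightarrow> (int ^ 'd) set \<Rightarrow> 'x set" where
  "Fix_points S \<alpha> \<Lambda> = {x \<in> S. \<forall>n\<in>\<Lambda>. \<alpha> n x = x}"

definition annihilator :: "(int ^ 'd) set \<Rightarrow> (complex ^ 'd) set" where
  "annihilator \<Lambda> = {z. (\<forall>i. cmod (z $ i) = 1) \<and> (\<forall>n\<in>\<Lambda>. monom_val z n = 1)}"

end

theory Submission
  imports Defs "Jordan_Normal_Form.Determinant"
begin

text \<open>
  A character of \<open>M\<^sub>A\<close> that is fixed by \<open>\<Lambda>\<close> is a homomorphism \<open>R\<^sup>k \<rightarrow> S\<^sup>1\<close> that vanishes on
  \<open>A R\<^sup>k\<close> and is invariant under the monomials \<open>u\<^sup>n\<close> with \<open>n \<in> \<Lambda>\<close>. As an abelian group \<open>R\<^sup>k\<close> is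
  free on the elements \<open>u\<^sup>n e\<^sub>i\<close>, so such a homomorphism is the same as a configuration
  \<open>x : \<int>\<^sup>d \<times> {1..k} \<rightarrow> S\<^sup>1\<close> that is \<open>\<Lambda>\<close>-periodic and satisfies the relations imposed by the
  elements \<open>u\<^sup>n A e\<^sub>j\<close> (\<open>bij_betw_Fix_points_lifted_fix\<close>, \<open>bij_betw_lifted_fix_config_fix\<close>).
  With \<open>m\<close> the index of \<open>\<Lambda>\<close>, periodic configurations are points of the torus
  \<open>(S\<^sup>1)\<^bsup>mk\<^esup>\<close>, and the relations say that such a point is in the kernel of the endomorphism
  given by an integer matrix \<open>B\<close> of size \<open>mk\<close>
  (\<open>bij_betw_config_fix_torus_kernel\<close>).

  The kernel of an integer matrix on a torus has \<open>\<bar>det B\<bar>\<close> elements, or is infinite if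
  \<open>det B = 0\<close> (\<open>card_torus_kernel\<close>): integral row operations change neither side, so the first
  column may be cleared below its top entry \<open>g\<close>. The first coordinate of a point of the kernel is
  then a \<open>g\<close>-th root of an expression in the others, and the others form a point of the kernel
  of the remaining minor.

  Up to transposition, \<open>B\<close> is the action of \<open>A\<close> on \<open>\<int>[\<int>\<^sup>d/\<Lambda>]\<^sup>k\<close>. Over the complex numbers the finite Fourier
  transform, built from the characters \<open>n \<mapsto> z\<^sup>n\<close> for \<open>z \<in> \<Lambda>\<^sup>\<bottom>\<close>, turns it into the block diagonal
  matrix with blocks \<open>A(z)\<close>, up to transposition. Hence \<open>det B\<close> is the product of the
  \<open>det(A)(z)\<close> (\<open>det_period_mat\<close>). The Fourier matrix is square and invertible because there
  are exactly \<open>m\<close> such characters and they are orthogonal (\<open>card_annihilator\<close>,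
  \<open>annihilator_orthogonal\<close>); the count rests on characters of \<open>\<int>\<^sup>d/\<Lambda>\<close> separating points, which
  follows by extending characters one generator at a time.
\<close>

text \<open>
  Two kinds of matrices occur: those indexed by finite types, and those indexed by
  natural numbers, whose size may vary in an induction. The short names and \<open>$\<close> are kept for
  the former; the determinant of the latter is \<open>Determinant.det\<close>.
\<close>

hide_const (open) Determinant.det
no_notation vec_index (infixl "$" 100)
hide_type (open) Matrix.vec
hide_fact (open) Matrix.vec_eq_iff

section \<open>Kernels of integer matrices on tori\<close>

text \<open>
  A point of the torus \<open>(S\<^sup>1)\<^sup>n\<close> is padded with \<open>1\<close> beyond \<open>n\<close>, so that removing the first
  coordinate is composition with \<open>Suc\<close>.
\<close>

definition torus_kernel :: "nat \<Rightarrow> int mat \<Rightarrow> (nat \<Rightarrow> complex) set" where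
  "torus_kernel n B = {x. (\<forall>c. cmod (x c) = 1) \<and> (\<forall>c\<ge>n. x c = 1) \<and>
     (\<forall>r<n. (\<Prod>c<n. x c powi (B $$ (r, c))) = 1)}"

lemma prod_powi: "(\<Prod>c\<in>S. f c powi a) = (\<Prod>c\<in>S. f c :: complex) powi a"
  by (induction S rule: infinite_finite_induct) (auto simp: power_int_mult_distrib)

text \<open>
  In multiplicative notation the new row condition is a power of an old one times another old
  one, and the operation can be undone.
\<close>

lemma torus_kernel_addrow:
  assumes B: "B \<in> carrier_mat n n" and k: "k < n" "l < n" "k \<noteq> l"
  shows "torus_kernel n (addrow a k l B) = torus_kernel n B"
proof -
  have "(\<forall>r<n. (\<Prod>c<n. x c powi (addrow a k l B $$ (r, c))) = 1) \<longleftrightarrow>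
        (\<forall>r<n. (\<Prod>c<n. x c powi (B $$ (r, c))) = 1)" (is "(\<forall>r<n. ?P r = 1) \<longleftrightarrow> (\<forall>r<n. ?Q r = 1)")
    if x: "\<forall>c. cmod (x c) = 1" for x :: "nat \<Rightarrow> complex"
  proof -
    have nz: "x c \<noteq> 0" for c using x[rule_format, of c] by auto
    have 1: "?P r = ?Q r" if "r < n" "r \<noteq> k" for r
      by (rule prod.cong) (use that B in auto)
    have "?P k = (\<Prod>c<n. x c powi (B $$ (l, c) * a) * x c powi (B $$ (k, c)))"
      by (rule prod.cong) (use k B nz in \<open>auto simp: power_int_add mult.commute\<close>)
    also have "\<dots> = ?Q l powi a * ?Q k"
      by (simp add: prod.distrib power_int_mult prod_powi)
    finally have 2: "?P k = ?Q l powi a * ?Q k" .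
    show ?thesis
    proof
      assume P: "\<forall>r<n. ?P r = 1"
      then have "?Q l = 1" using 1[of l] k by simp
      with P 2 k have "?Q k = 1" by simp
      show "\<forall>r<n. ?Q r = 1"
      proof (intro allI impI)
        fix r assume "r < n"
        then show "?Q r = 1" using \<open>?Q k = 1\<close> P 1[of r] by (cases "r = k") auto
      qed
    next
      assume Q: "\<forall>r<n. ?Q r = 1"
      then have "?P k = 1" using 2 k by simp
      show "\<forall>r<n. ?P r = 1"
      proof (intro allI impI)
        fix r assume "r < n"
        then show "?P r = 1" using \<open>?P k = 1\<close> Q 1[of r] by (cases "r = k") auto
      qed
    qed
  qed
  then show ?thesis unfolding torus_kernel_def by blast
qed

text \<open>
  Euclid's algorithm on the entries of the first column, with the sum of their absolute values as
  the decreasing measure.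
\<close>

lemma clear_first_column:
  assumes "B \<in> carrier_mat (Suc n) (Suc n)"
  obtains C where "C \<in> carrier_mat (Suc n) (Suc n)" "Determinant.det C = Determinant.det B"
    "torus_kernel (Suc n) C = torus_kernel (Suc n) B" "\<And>r. 0 < r \<Longrightarrow> r < Suc n \<Longrightarrow> C $$ (r, 0) = 0"
proof -
  have "\<exists>C \<in> carrier_mat (Suc n) (Suc n). Determinant.det C = Determinant.det B \<and>
    torus_kernel (Suc n) C = torus_kernel (Suc n) B \<and> (\<forall>r. 0 < r \<longrightarrow> r < Suc n \<longrightarrow> C $$ (r, 0) = 0)"
    using assms
  proof (induction "\<Sum>r<Suc n. nat \<bar>B $$ (r, 0)\<bar>" arbitrary: B rule: less_induct)
    case less
    note B = less.prems
    let ?N = "Suc n"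
    show ?case
    proof (cases "\<exists>r s. r < ?N \<and> s < ?N \<and> r \<noteq> s \<and> B $$ (s, 0) \<noteq> 0 \<and> \<bar>B $$ (s, 0)\<bar> \<le> \<bar>B $$ (r, 0)\<bar>")
      case True
      then obtain r s where rs: "r < ?N" "s < ?N" "r \<noteq> s" "B $$ (s, 0) \<noteq> 0"
        "\<bar>B $$ (s, 0)\<bar> \<le> \<bar>B $$ (r, 0)\<bar>" by blast
      \<comment> \<open>Subtracting the smaller entry, up to sign, from the larger one decreases the latter in absolute value.\<close>
      define a where "a = - (sgn (B $$ (r, 0)) * sgn (B $$ (s, 0)))"
      define C where "C = addrow a r s B"
      have C: "C \<in> carrier_mat ?N ?N" unfolding C_def using B by simp
      have entry: "C $$ (t, 0) = (if t = r then a * B $$ (s, 0) + B $$ (r, 0) else B $$ (t, 0))"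
        if "t < ?N" for t
        unfolding C_def using B that rs by auto
      have "\<bar>a * B $$ (s, 0) + B $$ (r, 0)\<bar> < \<bar>B $$ (r, 0)\<bar>"
        unfolding a_def using rs(4,5) by (auto simp: sgn_if)
      then have "(\<Sum>t<?N. nat \<bar>C $$ (t, 0)\<bar>) < (\<Sum>t<?N. nat \<bar>B $$ (t, 0)\<bar>)"
        by (intro sum_strict_mono_ex1) (use rs(1) in \<open>auto simp: entry intro!: bexI[of _ r]\<close>)
      moreover have "Determinant.det C = Determinant.det B" "torus_kernel ?N C = torus_kernel ?N B"
        unfolding C_def using det_addrow[OF rs(2,3) B] torus_kernel_addrow[OF B rs(1,2,3)] by auto
      ultimately show ?thesis using less.hyps[OF _ C] by metis
    next
      case False
      then have one: "B $$ (r, 0) = 0 \<or> B $$ (s, 0) = 0" if "r < ?N" "s < ?N" "r \<noteq> s" for r s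
        using that by (metis linorder_linear)
      show ?thesis
      proof (cases "\<exists>r. 0 < r \<and> r < ?N \<and> B $$ (r, 0) \<noteq> 0")
        case True
        then obtain r where r: "0 < r" "r < ?N" "B $$ (r, 0) \<noteq> 0" by blast
        \<comment> \<open>The only nonzero entry is in row r: copy it to the top and subtract the top row from row r.\<close>
        define C where "C = addrow 1 0 r B"
        define D where "D = addrow (-1) r 0 C"
        have C: "C \<in> carrier_mat ?N ?N" unfolding C_def using B by simp
        have D: "D \<in> carrier_mat ?N ?N" unfolding D_def using C by simp
        have "Determinant.det C = Determinant.det B" "torus_kernel ?N C = torus_kernel ?N B"
          unfolding C_def using det_addrow[of r ?N 0 B 1] torus_kernel_addrow[of B ?N 0 r 1] B r by auto
        moreover have "Determinant.det D = Determinant.det C" "torus_kernel ?N D = torus_kernel ?N C"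
          unfolding D_def using det_addrow[of 0 ?N r C "-1"] torus_kernel_addrow[of C ?N r 0 "-1"] C r by auto
        moreover have "D $$ (t, 0) = 0" if "0 < t" "t < ?N" for t
        proof (cases "t = r")
          case True
          have "B $$ (0, 0) = 0" using one[of r 0] r by auto
          then show ?thesis unfolding D_def C_def using B r True by auto
        next
          case False
          have "B $$ (t, 0) = 0" using one[of t r] r that False by auto
          then show ?thesis unfolding D_def C_def using B r that False by auto
        qed
        ultimately show ?thesis using D by auto
      next
        case False
        then show ?thesis by (intro bexI[of _ B]) (use B in blast)+
      qed
    qed
  qed
  then obtain C where "C \<in> carrier_mat (Suc n) (Suc n)" "Determinant.det C = Determinant.det B"
    "torus_kernel (Suc n) C = torus_kernel (Suc n) B" "\<forall>r. 0 < r \<longrightarrow> r < Suc n \<longrightarrow> C $$ (r, 0) = 0"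
    by (elim bexE conjE)
  then show ?thesis by (intro that[of C]) simp_all
qed

lemma unit_roots_powi:
  assumes g: "g \<noteq> 0" and v: "cmod v = 1"
  shows "finite {w. cmod w = 1 \<and> w powi g * v = 1}"
    and "card {w. cmod w = 1 \<and> w powi g * v = 1} = nat \<bar>g\<bar>"
proof -
  define u where "u = (if g > 0 then inverse v else v)"
  have v0: "v \<noteq> 0" "u \<noteq> 0" and u: "cmod u = 1" using v by (auto simp: u_def norm_inverse)
  have "{w. cmod w = 1 \<and> w powi g * v = 1} = {w. w ^ nat \<bar>g\<bar> = u}"
  proof (intro Collect_cong iffI conjI)
    fix w assume "cmod w = 1 \<and> w powi g * v = 1"
    then show "w ^ nat \<bar>g\<bar> = u" using v0 unfolding u_def power_int_def
      by (auto simp: field_simps split: if_splits)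
  next
    fix w assume w: "w ^ nat \<bar>g\<bar> = u"
    then have "cmod w ^ nat \<bar>g\<bar> = 1" using u by (metis norm_power)
    then show "cmod w = 1" using g power_eq_imp_eq_base[of "cmod w" "nat \<bar>g\<bar>" 1] by simp
    show "w powi g * v = 1" using w v0 g unfolding u_def power_int_def
      by (auto simp: field_simps split: if_splits)
  qed
  then show "finite {w. cmod w = 1 \<and> w powi g * v = 1}"
    and "card {w. cmod w = 1 \<and> w powi g * v = 1} = nat \<bar>g\<bar>"
    using card_nth_roots[OF v0(2), of "nat \<bar>g\<bar>"] finite_nth_roots[of "nat \<bar>g\<bar>" u] g by auto
qed

lemma infinite_circle: "infinite {w::complex. cmod w = 1}"
proof
  assume fin: "finite {w::complex. cmod w = 1}"
  have "card {w::complex. w ^ Suc n = 1} = Suc n" for n by (rule card_nth_roots) auto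
  moreover have "{w::complex. w ^ Suc n = 1} \<subseteq> {w. cmod w = 1}" for n
    by (metis (mono_tags, lifting) Collect_mono norm_one norm_power power_eq_1_iff norm_ge_zero nat.distinct(1))
  ultimately have "Suc n \<le> card {w::complex. cmod w = 1}" for n
    using card_mono[OF fin] by metis
  then show False using not_less_eq_eq by blast
qed

text \<open>
  Only the top condition involves the first coordinate.
\<close>

lemma torus_kernel_Suc:
  assumes C: "C \<in> carrier_mat (Suc n) (Suc n)"
    and zero: "\<And>r. 0 < r \<Longrightarrow> r < Suc n \<Longrightarrow> C $$ (r, 0) = 0"
  shows "bij_betw (\<lambda>x. (x \<circ> Suc, x 0)) (torus_kernel (Suc n) C)
    (SIGMA y:torus_kernel n (mat_delete C 0 0).
       {w. cmod w = 1 \<and> w powi (C $$ (0, 0)) * (\<Prod>c<n. y c powi (C $$ (0, Suc c))) = 1})"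
proof -
  let ?D = "mat_delete C 0 0"
  have D: "?D $$ (r, c) = C $$ (Suc r, Suc c)" if "r < n" "c < n" for r c
    using mat_delete_index[OF C, of 0 0 r c] that by (simp add: insert_index_def)
  have row: "(\<Prod>c<Suc n. x c powi (C $$ (Suc r, c))) = (\<Prod>c<n. x (Suc c) powi (?D $$ (r, c)))"
    if "r < n" for x :: "nat \<Rightarrow> complex" and r
    using that by (simp only: prod.lessThan_Suc_shift zero) (simp add: D)
  have mem: "x \<in> torus_kernel (Suc n) C \<longleftrightarrow> x \<circ> Suc \<in> torus_kernel n ?D \<and> cmod (x 0) = 1 \<and>
      x 0 powi (C $$ (0, 0)) * (\<Prod>c<n. (x \<circ> Suc) c powi (C $$ (0, Suc c))) = 1" for x
  proof -
    have "(\<forall>r<Suc n. (\<Prod>c<Suc n. x c powi (C $$ (r, c))) = 1) \<longleftrightarrow>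
      (\<Prod>c<Suc n. x c powi (C $$ (0, c))) = 1 \<and> (\<forall>r<n. (\<Prod>c<n. x (Suc c) powi (?D $$ (r, c))) = 1)"
      unfolding All_less_Suc2 using row by auto
    moreover have "(\<forall>c. cmod (x c) = 1) \<longleftrightarrow> cmod (x 0) = 1 \<and> (\<forall>c. cmod (x (Suc c)) = 1)"
      by (metis nat.exhaust)
    moreover have "(\<forall>c\<ge>Suc n. x c = 1) \<longleftrightarrow> (\<forall>c\<ge>n. x (Suc c) = 1)"
      by (metis Suc_le_D Suc_le_mono)
    ultimately show ?thesis unfolding torus_kernel_def
      by (auto simp: prod.lessThan_Suc_shift simp del: prod.lessThan_Suc)
  qed
  show ?thesis
  proof (rule bij_betw_byWitness[where f' = "\<lambda>(y, w). case_nat w y"])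
    show "\<forall>a\<in>torus_kernel (Suc n) C. (case (a \<circ> Suc, a 0) of (y, w) \<Rightarrow> case_nat w y) = a"
      by (auto simp: fun_eq_iff split: nat.splits)
    have o: "case_nat w y \<circ> Suc = y" for w :: complex and y by (auto simp: fun_eq_iff)
    show "\<forall>a'\<in>(SIGMA y:torus_kernel n ?D.
       {w. cmod w = 1 \<and> w powi (C $$ (0, 0)) * (\<Prod>c<n. y c powi (C $$ (0, Suc c))) = 1}).
       ((case a' of (y, w) \<Rightarrow> case_nat w y) \<circ> Suc, (case a' of (y, w) \<Rightarrow> case_nat w y) 0) = a'"
      by (auto simp: o)
    show "(\<lambda>x. (x \<circ> Suc, x 0)) ` torus_kernel (Suc n) C \<subseteq> (SIGMA y:torus_kernel n ?D.
       {w. cmod w = 1 \<and> w powi (C $$ (0, 0)) * (\<Prod>c<n. y c powi (C $$ (0, Suc c))) = 1})"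
      by (auto simp: mem)
    show "(\<lambda>(y, w). case_nat w y) ` (SIGMA y:torus_kernel n ?D.
       {w. cmod w = 1 \<and> w powi (C $$ (0, 0)) * (\<Prod>c<n. y c powi (C $$ (0, Suc c))) = 1})
       \<subseteq> torus_kernel (Suc n) C"
      by (auto simp: mem o)
  qed
qed

lemma det_first_column:
  assumes C: "C \<in> carrier_mat (Suc n) (Suc n)"
    and zero: "\<And>r. 0 < r \<Longrightarrow> r < Suc n \<Longrightarrow> C $$ (r, 0) = 0"
  shows "Determinant.det C = C $$ (0, 0) * Determinant.det (mat_delete C 0 0)"
proof -
  have "Determinant.det C = (\<Sum>i<Suc n. C $$ (i, 0) * cofactor C i 0)"
    by (rule laplace_expansion_column[OF C]) simp
  also have "\<dots> = C $$ (0, 0) * cofactor C 0 0"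
    by (simp add: sum.lessThan_Suc_shift zero del: sum.lessThan_Suc)
  finally show ?thesis by (simp add: cofactor_def)
qed

text \<open>
  The fibre of the projection that forgets the first coordinate is a set of \<open>g\<close>-th roots: it has
  \<open>\<bar>g\<bar>\<close> elements if \<open>g \<noteq> 0\<close>, and for \<open>g = 0\<close> it is the whole circle over the neutral element. This
  mirrors \<open>det B = g det D\<close>, where \<open>D\<close> is the minor left after the reduction.
\<close>

theorem card_torus_kernel:
  assumes "B \<in> carrier_mat n n"
  shows "if Determinant.det B = 0 then infinite (torus_kernel n B)
         else finite (torus_kernel n B) \<and> card (torus_kernel n B) = nat \<bar>Determinant.det B\<bar>"
  using assms
proof (induction n arbitrary: B)
  case 0
  have "torus_kernel 0 B = {\<lambda>_. 1}" unfolding torus_kernel_def by (auto simp: fun_eq_iff)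
  moreover have "Determinant.det B = 1" using 0 by (simp add: Determinant.det_def)
  ultimately show ?case by simp
next
  case (Suc n)
  obtain C where C: "C \<in> carrier_mat (Suc n) (Suc n)" and detC: "Determinant.det C = Determinant.det B"
    and tk: "torus_kernel (Suc n) C = torus_kernel (Suc n) B"
    and zero: "\<And>r. 0 < r \<Longrightarrow> r < Suc n \<Longrightarrow> C $$ (r, 0) = 0"
    using clear_first_column[OF Suc.prems] by metis
  define D where "D = mat_delete C 0 0"
  have D: "D \<in> carrier_mat n n" unfolding D_def using mat_delete_carrier[OF C] by simp
  define g where "g = C $$ (0, 0)"
  define v where "v y = (\<Prod>c<n. y c powi (C $$ (0, Suc c)))" for y :: "nat \<Rightarrow> complex"
  define R where "R y = {w. cmod w = 1 \<and> w powi g * v y = 1}" for y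
  have det: "Determinant.det B = g * Determinant.det D"
    using det_first_column[OF C zero] detC by (simp add: g_def D_def)
  have bij: "bij_betw (\<lambda>x. (x \<circ> Suc, x 0)) (torus_kernel (Suc n) B) (Sigma (torus_kernel n D) R)"
    using torus_kernel_Suc[OF C zero] unfolding tk R_def g_def v_def D_def .
  note fin = bij_betw_finite[OF bij] and card = bij_betw_same_card[OF bij]
  note IH = Suc.IH[OF D]
  show ?case
  proof (cases "g = 0")
    case True
    have "(\<lambda>_. 1) \<in> torus_kernel n D" unfolding torus_kernel_def by simp
    moreover have "R (\<lambda>_. 1) = {w. cmod w = 1}" unfolding R_def v_def using True by simp
    ultimately have "Pair (\<lambda>_. 1) ` {w. cmod w = 1} \<subseteq> Sigma (torus_kernel n D) R" by auto
    moreover have "infinite (Pair (\<lambda>_::nat. 1::complex) ` {w::complex. cmod w = 1})"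
      by (subst finite_image_iff) (auto simp: inj_on_def infinite_circle)
    ultimately show ?thesis using True det fin finite_subset by auto
  next
    case g: False
    have v: "cmod (v y) = 1" if "y \<in> torus_kernel n D" for y
      using that unfolding v_def torus_kernel_def by (simp add: prod_norm[symmetric] norm_power_int)
    have R: "finite (R y)" "card (R y) = nat \<bar>g\<bar>" if "y \<in> torus_kernel n D" for y
      unfolding R_def using unit_roots_powi[OF g v[OF that]] by auto
    show ?thesis
    proof (cases "Determinant.det D = 0")
      case True
      \<comment> \<open>All fibres are nonempty, so an infinite kernel of D gives an infinite kernel of B.\<close>
      have "torus_kernel n D \<subseteq> fst ` Sigma (torus_kernel n D) R"
      proof
        fix y assume y: "y \<in> torus_kernel n D"
        then have "R y \<noteq> {}" using R[OF y] g by auto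
        then show "y \<in> fst ` Sigma (torus_kernel n D) R" using y by force
      qed
      then show ?thesis using True det fin IH by (metis finite_imageI finite_subset mult_zero_right)
    next
      case False
      then have D': "finite (torus_kernel n D)" "card (torus_kernel n D) = nat \<bar>Determinant.det D\<bar>"
        using IH by auto
      have "card (Sigma (torus_kernel n D) R) = (\<Sum>y\<in>torus_kernel n D. card (R y))"
        by (rule card_SigmaI) (use D' R in auto)
      also have "\<dots> = nat \<bar>g\<bar> * nat \<bar>Determinant.det D\<bar>" using R D' by simp
      finally show ?thesis using fin card False g det D' R
        by (auto simp: abs_mult nat_mult_distrib intro!: finite_SigmaI)
    qed
  qed
qed

section \<open>The annihilator of a lattice\<close>

definition char_on :: "(int ^ 'd) set \<Rightarrow> (int ^ 'd \<Rightarrow> complex) \<Rightarrow> bool" where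
  "char_on H \<theta> \<longleftrightarrow> 0 \<in> H \<and> (\<forall>x\<in>H. \<forall>y\<in>H. x - y \<in> H) \<and> (\<forall>x\<in>H. cmod (\<theta> x) = 1) \<and>
     (\<forall>x\<in>H. \<forall>y\<in>H. \<theta> (x + y) = \<theta> x * \<theta> y)"

lemma char_onD:
  assumes "char_on H \<theta>"
  shows char_on_0: "0 \<in> H" and char_on_diff: "x \<in> H \<Longrightarrow> y \<in> H \<Longrightarrow> x - y \<in> H"
    and char_on_uminus: "x \<in> H \<Longrightarrow> - x \<in> H"
    and char_on_plus: "x \<in> H \<Longrightarrow> y \<in> H \<Longrightarrow> x + y \<in> H"
    and char_on_norm: "x \<in> H \<Longrightarrow> cmod (\<theta> x) = 1"
    and char_on_mult: "x \<in> H \<Longrightarrow> y \<in> H \<Longrightarrow> \<theta> (x + y) = \<theta> x * \<theta> y"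
    and char_on_zero: "\<theta> 0 = 1"
proof -
  note d = assms[unfolded char_on_def]
  show 0: "0 \<in> H" and 1: "x \<in> H \<Longrightarrow> y \<in> H \<Longrightarrow> x - y \<in> H" for x y using d by auto
  show 2: "x \<in> H \<Longrightarrow> - x \<in> H" for x using 1[OF 0, of x] by simp
  show "x \<in> H \<Longrightarrow> y \<in> H \<Longrightarrow> x + y \<in> H" for x y using 1[OF _ 2, of x y] by simp
  show 3: "x \<in> H \<Longrightarrow> cmod (\<theta> x) = 1" for x using d by auto
  show 4: "x \<in> H \<Longrightarrow> y \<in> H \<Longrightarrow> \<theta> (x + y) = \<theta> x * \<theta> y" for x y using d by auto
  show "\<theta> 0 = 1" using 4[OF 0 0] 3[OF 0] by auto
qed

lemma char_on_scale:
  assumes "char_on H \<theta>" "x \<in> H"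
  shows "t *s x \<in> H \<and> \<theta> (t *s x) = \<theta> x powi t"
proof (induction t rule: int_induct[where k = 0])
  case base
  then show ?case using char_onD[OF assms(1)] by simp
next
  case (step1 i)
  have nz: "\<theta> x \<noteq> 0" using char_on_norm[OF assms] by auto
  have "(i + 1) *s x = i *s x + x" by (simp add: vector_sadd_rdistrib)
  then show ?case using step1 assms char_onD[OF assms(1)] nz
    by (simp add: power_int_add)
next
  case (step2 i)
  have nz: "\<theta> x \<noteq> 0" using char_on_norm[OF assms] by auto
  have *: "(i - 1) *s x + x = i *s x" "(i - 1) *s x = i *s x - x"
    by (simp_all add: vec_eq_iff algebra_simps)
  then have mem: "(i - 1) *s x \<in> H" using step2 assms char_on_diff[OF assms(1)] by auto
  then have "\<theta> x powi i = \<theta> ((i - 1) *s x) * \<theta> x"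
    using char_on_mult[OF assms(1) mem assms(2)] * step2 by simp
  then show ?case using mem nz by (simp add: power_int_diff)
qed

text \<open>
  Extension of a character by one element \<open>g\<close> whose order modulo \<open>H\<close> is \<open>N\<close>: the value
  \<open>\<zeta>\<close> at \<open>g\<close> may be any \<open>N\<close>-th root of the value at \<open>N g\<close>. The freedom in \<open>\<zeta>\<close> is what makes characters
  separate points.
\<close>

lemma char_on_extend_step:
  assumes \<theta>: "char_on H \<theta>"
    and N: "N > 0" "int N *s g \<in> H" "\<And>k. 0 < k \<Longrightarrow> k < N \<Longrightarrow> int k *s g \<notin> H"
    and \<zeta>: "\<zeta> ^ N = \<theta> (int N *s g)"
  obtains H' \<theta>' where "char_on H' \<theta>'" "H \<subseteq> H'" "g \<in> H'" "\<And>x. x \<in> H \<Longrightarrow> \<theta>' x = \<theta> x" "\<theta>' g = \<zeta>"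
proof -
  have "cmod \<zeta> ^ N = 1" using \<zeta> char_on_norm[OF \<theta> N(2)] by (metis norm_power)
  then have norm\<zeta>: "cmod \<zeta> = 1" using N(1) power_eq_imp_eq_base[of "cmod \<zeta>" N 1] by simp
  then have nz: "\<zeta> \<noteq> 0" by auto
  define H' where "H' = {x. \<exists>k. x - k *s g \<in> H}"
  define \<theta>' where "\<theta>' x = (let k = SOME k. x - k *s g \<in> H in \<theta> (x - k *s g) * \<zeta> powi k)" for x
  \<comment> \<open>Two representations of x differ by a multiple of N, because N is the order of g modulo H.\<close>
  have wd: "\<theta> (x - l *s g) * \<zeta> powi l = \<theta> (x - k *s g) * \<zeta> powi k"
    if "x - k *s g \<in> H" "x - l *s g \<in> H" for x k l
  proof -
    have "(k - l) *s g = (x - l *s g) - (x - k *s g)" by (simp add: vec_eq_iff algebra_simps)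
    then have kl: "(k - l) *s g \<in> H" using char_on_diff[OF \<theta> that(2,1)] by simp
    define r where "r = (k - l) mod int N"
    have "r *s g = (k - l) *s g - ((k - l) div int N) *s (int N *s g)"
      unfolding r_def by (simp add: vec_eq_iff minus_div_mult_eq_mod[symmetric] algebra_simps)
    then have "r *s g \<in> H"
      using char_on_diff[OF \<theta> kl] char_on_scale[OF \<theta> N(2)] by metis
    moreover have "0 \<le> r" "r < int N" using N(1) by (auto simp: r_def)
    ultimately have "r = 0" using N(3)[of "nat r"] by (metis int_nat_eq nat_less_iff of_nat_0_less_iff order_le_less)
    then obtain t where t: "k - l = t * int N" unfolding r_def by (metis dvd_def mod_0_imp_dvd mult.commute)
    have eq: "x - l *s g = (x - k *s g) + t *s (int N *s g)"
    proof -
      have "x - l *s g = (x - k *s g) + (k - l) *s g" by (simp add: vec_eq_iff algebra_simps)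
      then show ?thesis unfolding t by (simp add: vector_smult_assoc)
    qed
    have "\<theta> (x - l *s g) = \<theta> (x - k *s g) * \<theta> (int N *s g) powi t"
      unfolding eq using char_on_scale[OF \<theta> N(2), of t] char_on_mult[OF \<theta> that(1)] by simp
    also have "\<theta> (int N *s g) powi t = \<zeta> powi (k - l)"
      unfolding t \<zeta>[symmetric] by (simp only: mult.commute[of t] power_int_mult power_int_of_nat)
    finally show ?thesis using nz by (simp add: power_int_diff)
  qed
  have \<theta>': "\<theta>' x = \<theta> (x - k *s g) * \<zeta> powi k" if "x - k *s g \<in> H" for x k
    unfolding \<theta>'_def Let_def by (rule wd[OF that]) (rule someI[of "\<lambda>k. x - k *s g \<in> H", OF that])
  have sub: "x - 0 *s g = x" for x :: "int ^ 'a" by simp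
  have "char_on H' \<theta>'"
    unfolding char_on_def
  proof (intro conjI ballI)
    show "0 \<in> H'" unfolding H'_def using char_on_0[OF \<theta>] by (auto intro!: exI[of _ 0])
  next
    fix x y assume "x \<in> H'" "y \<in> H'"
    then obtain k l where kl: "x - k *s g \<in> H" "y - l *s g \<in> H" by (auto simp: H'_def)
    have d: "x - y - (k - l) *s g = (x - k *s g) - (y - l *s g)" by (simp add: vec_eq_iff algebra_simps)
    have "x - y - (k - l) *s g \<in> H" unfolding d by (rule char_on_diff[OF \<theta> kl])
    then show "x - y \<in> H'" unfolding H'_def by blast
    have e: "x + y - (k + l) *s g = (x - k *s g) + (y - l *s g)" by (simp add: vec_eq_iff algebra_simps)
    have "\<theta>' (x + y) = \<theta> (x + y - (k + l) *s g) * \<zeta> powi (k + l)"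
      by (rule \<theta>') (unfold e, rule char_on_plus[OF \<theta> kl])
    then show "\<theta>' (x + y) = \<theta>' x * \<theta>' y"
      unfolding e \<theta>'[OF kl(1)] \<theta>'[OF kl(2)] char_on_mult[OF \<theta> kl] using nz by (simp add: power_int_add)
  next
    fix x assume "x \<in> H'"
    then obtain k where k: "x - k *s g \<in> H" by (auto simp: H'_def)
    then show "cmod (\<theta>' x) = 1"
      using char_on_norm[OF \<theta> k] norm\<zeta> by (simp add: \<theta>'[OF k] norm_mult norm_power_int)
  qed
  moreover have "H \<subseteq> H'" unfolding H'_def using sub by (force intro: exI[of _ 0])
  moreover have g: "g - 1 *s g \<in> H" using char_on_0[OF \<theta>] by simp
  then have "g \<in> H'" unfolding H'_def by blast
  moreover have "\<theta>' g = \<zeta>" using \<theta>'[OF g] char_on_zero[OF \<theta>] by simp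
  moreover have "\<theta>' x = \<theta> x" if "x \<in> H" for x using \<theta>'[of x 0] that by simp
  ultimately show ?thesis using that by blast
qed

text \<open>
  A subgroup of index \<open>m\<close>, with its cosets numbered by \<open>cls\<close> and represented by \<open>rep\<close>. The numbering
  serves to index the rows and columns of matrices by cosets.
\<close>

locale finite_index =
  fixes \<Lambda> :: "(int ^ 'd::finite) set" and m :: nat
    and cls :: "int ^ 'd \<Rightarrow> nat" and rep :: "nat \<Rightarrow> int ^ 'd"
  assumes zero_mem: "0 \<in> \<Lambda>" and diff_mem: "x \<in> \<Lambda> \<Longrightarrow> y \<in> \<Lambda> \<Longrightarrow> x - y \<in> \<Lambda>"
    and cls_less: "cls x < m" and cls_eq_iff: "cls x = cls y \<longleftrightarrow> x - y \<in> \<Lambda>"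
    and cls_rep: "a < m \<Longrightarrow> cls (rep a) = a"
begin

lemma m_pos: "m > 0" using cls_less[of 0] by simp

text \<open>
  Two of the \<open>m + 1\<close> multiples \<open>0, g, \<dots>, m g\<close> lie in the same coset.
\<close>

lemma multiple_mem: obtains N where "N > 0" "int N *s g \<in> \<Lambda>"
proof -
  have "\<not> inj_on (\<lambda>k. cls (int k *s g)) {..m}"
  proof
    assume "inj_on (\<lambda>k. cls (int k *s g)) {..m}"
    moreover have "(\<lambda>k. cls (int k *s g)) ` {..m} \<subseteq> {..<m}" using cls_less by auto
    ultimately show False using card_inj_on_le[of _ "{..m}" "{..<m}"] by fastforce
  qed
  then obtain j k where "j \<noteq> k" "cls (int j *s g) = cls (int k *s g)" unfolding inj_on_def by blast
  then obtain j k where jk: "j < k" "cls (int k *s g) = cls (int j *s g)" by (metis linorder_neq_iff)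
  then have "int k *s g - int j *s g \<in> \<Lambda>" by (simp add: cls_eq_iff)
  moreover have "int k *s g - int j *s g = int (k - j) *s g"
    using jk by (simp add: vec_eq_iff algebra_simps)
  ultimately have "int (k - j) *s g \<in> \<Lambda>" by metis
  then show ?thesis by (rule that[rotated]) (use jk in simp)
qed

text \<open>
  Repeated extension by one element; it ends because the subgroup \<open>H\<close> meets more cosets of \<open>\<Lambda>\<close> each time.
\<close>

lemma char_on_extend:
  assumes "char_on H \<theta>" "\<Lambda> \<subseteq> H"
  shows "\<exists>\<psi>. char_on UNIV \<psi> \<and> (\<forall>x\<in>H. \<psi> x = \<theta> x)"
  using assms
proof (induction "m - card (cls ` H)" arbitrary: H \<theta> rule: less_induct)
  case less
  show ?case
  proof (cases "H = UNIV")
    case False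
    then obtain g where g: "g \<notin> H" by blast
    define N where "N = (LEAST N. N > 0 \<and> int N *s g \<in> H)"
    have "\<exists>N. N > 0 \<and> int N *s g \<in> H" using multiple_mem[of g] less.prems(2) by blast
    then have N: "N > 0 \<and> int N *s g \<in> H" unfolding N_def by (rule LeastI_ex)
    have minN: "int k *s g \<notin> H" if "0 < k" "k < N" for k
      using not_less_Least[of k "\<lambda>N. N > 0 \<and> int N *s g \<in> H"] that unfolding N_def by blast
    have "card {w. w ^ N = \<theta> (int N *s g)} = N"
      by (rule card_nth_roots) (use N char_on_norm[OF less.prems(1), of "int N *s g"] in auto)
    then have "{w. w ^ N = \<theta> (int N *s g)} \<noteq> {}" using N by (metis card.empty less_irrefl)
    then obtain \<zeta> where "\<zeta> ^ N = \<theta> (int N *s g)" by blast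
    with char_on_extend_step[OF less.prems(1)] N minN obtain H' \<theta>' where
      H': "char_on H' \<theta>'" "H \<subseteq> H'" "g \<in> H'" "\<And>x. x \<in> H \<Longrightarrow> \<theta>' x = \<theta> x" by metis
    have "cls g \<notin> cls ` H"
    proof
      assume "cls g \<in> cls ` H"
      then obtain h where h: "h \<in> H" "g - h \<in> \<Lambda>" by (auto simp: cls_eq_iff)
      then have "(g - h) + h \<in> H" using char_on_plus[OF less.prems(1)] less.prems(2) by blast
      then show False using g by simp
    qed
    then have "cls ` H \<subset> cls ` H'" using H' by blast
    moreover have sub: "cls ` H' \<subseteq> {..<m}" using cls_less by auto
    ultimately have "card (cls ` H) < card (cls ` H')"
      by (meson finite_lessThan finite_subset psubset_card_mono)
    moreover have "card (cls ` H') \<le> m" using card_mono[OF _ sub] by simp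
    ultimately have "m - card (cls ` H') < m - card (cls ` H)" by linarith
    from less.hyps[OF this H'(1)] H' less.prems(2) show ?thesis by (metis subset_iff)
  qed (use less.prems in blast)
qed

end

lemma monom_val_0 [simp]: "monom_val z 0 = 1"
  by (simp add: monom_val_def)

lemma monom_val_add:
  fixes z :: "complex ^ 'd::finite"
  assumes "\<forall>i. cmod (z $ i) = 1"
  shows "monom_val z (n + k) = monom_val z n * monom_val z k"
proof -
  have "z $ i \<noteq> 0" for i using assms[rule_format, of i] by auto
  then show ?thesis by (simp add: monom_val_def power_int_add prod.distrib)
qed

lemma norm_monom_val: "\<forall>i. cmod (z $ i) = 1 \<Longrightarrow> cmod (monom_val z n) = 1"
  by (simp add: monom_val_def prod_norm[symmetric] norm_power_int)

lemma monom_val_axis: "monom_val z (axis i 1) = z $ i"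
proof -
  have "monom_val z (axis i 1) = (\<Prod>j\<in>UNIV. if j = i then z $ j else 1)"
    unfolding monom_val_def by (rule prod.cong) (auto simp: axis_def)
  then show ?thesis by simp
qed

lemma monom_val_mult: "monom_val (\<chi> i. z $ i * w $ i) n = monom_val z n * monom_val w n"
  by (simp add: monom_val_def power_int_mult_distrib prod.distrib)

lemma monom_val_inverse: "monom_val (\<chi> i. inverse (z $ i)) n = inverse (monom_val z n)"
  by (simp add: monom_val_def power_int_inverse prod_inversef[symmetric] o_def)

lemma char_on_UNIV_eq_monom_val:
  fixes \<psi> :: "int ^ 'd::finite \<Rightarrow> complex"
  assumes "char_on UNIV \<psi>"
  shows "\<psi> n = monom_val (\<chi> i. \<psi> (axis i 1)) n"
proof -
  have "\<psi> (sum f S) = (\<Prod>i\<in>S. \<psi> (f i))" for f and S :: "'d set"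
    by (induction S rule: infinite_finite_induct)
      (auto simp: char_on_zero[OF assms] char_on_mult[OF assms])
  then have "\<psi> (\<Sum>i\<in>UNIV. n $ i *s axis i 1) = (\<Prod>i\<in>UNIV. \<psi> (axis i 1) powi (n $ i))"
    using char_on_scale[OF assms] by simp
  then show ?thesis by (simp add: basis_expansion monom_val_def)
qed

context finite_index
begin

lemma annihilator_norm: "z \<in> annihilator \<Lambda> \<Longrightarrow> \<forall>i. cmod (z $ i) = 1"
  by (simp add: annihilator_def)

lemma monom_val_cong:
  assumes "z \<in> annihilator \<Lambda>" "cls n = cls k"
  shows "monom_val z n = monom_val z k"
proof -
  have "monom_val z (n - k) = 1" using assms by (simp add: annihilator_def cls_eq_iff)
  then show ?thesis using monom_val_add[OF annihilator_norm[OF assms(1)], of "n - k" k] by simp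
qed

text \<open>
  On the subgroup generated by \<open>\<Lambda>\<close> and \<open>n\<close> there is a character that is trivial on \<open>\<Lambda>\<close> and maps
  \<open>n\<close> to a root of unity \<open>\<zeta> \<noteq> 1\<close>. Extended to \<open>\<int>\<^sup>d\<close>, it is evaluation at a point of the annihilator.
\<close>

lemma annihilator_separates:
  assumes "n \<notin> \<Lambda>"
  obtains z where "z \<in> annihilator \<Lambda>" "monom_val z n \<noteq> 1"
proof -
  define N where "N = (LEAST N. N > 0 \<and> int N *s n \<in> \<Lambda>)"
  have "\<exists>N. N > 0 \<and> int N *s n \<in> \<Lambda>" using multiple_mem[of n] by blast
  then have N: "N > 0 \<and> int N *s n \<in> \<Lambda>" unfolding N_def by (rule LeastI_ex)
  have minN: "int k *s n \<notin> \<Lambda>" if "0 < k" "k < N" for k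
    using not_less_Least[of k "\<lambda>N. N > 0 \<and> int N *s n \<in> \<Lambda>"] that unfolding N_def by blast
  have "N \<noteq> 1" using N assms by auto
  then have "card {w::complex. w ^ N = 1} > 1" using N card_nth_roots[of 1 N] by simp
  then have "\<not> {w::complex. w ^ N = 1} \<subseteq> {1}" by (metis card_mono card.empty card_insert_disjoint empty_iff finite.intros leD One_nat_def)
  then obtain \<zeta> :: complex where \<zeta>: "\<zeta> ^ N = 1" "\<zeta> \<noteq> 1" by blast
  have triv: "char_on \<Lambda> (\<lambda>_. 1)" unfolding char_on_def using zero_mem diff_mem by auto
  obtain H' \<theta>' where H': "char_on H' \<theta>'" "\<Lambda> \<subseteq> H'" "n \<in> H'" "\<And>x. x \<in> \<Lambda> \<Longrightarrow> \<theta>' x = 1" "\<theta>' n = \<zeta>"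
    using char_on_extend_step[OF triv, of N n \<zeta>] N minN \<zeta> by metis
  then obtain \<psi> where \<psi>: "char_on UNIV \<psi>" "\<forall>x\<in>H'. \<psi> x = \<theta>' x" using char_on_extend by metis
  have "(\<chi> i. \<psi> (axis i 1)) \<in> annihilator \<Lambda>"
    unfolding annihilator_def
    using char_on_norm[OF \<psi>(1)] char_on_UNIV_eq_monom_val[OF \<psi>(1), symmetric] \<psi>(2) H'(2,4) by auto
  moreover have "monom_val (\<chi> i. \<psi> (axis i 1)) n \<noteq> 1"
    using char_on_UNIV_eq_monom_val[OF \<psi>(1), symmetric] \<psi>(2) H'(3,5) \<zeta> by auto
  ultimately show ?thesis using that by blast
qed

lemma finite_annihilator: "finite (annihilator \<Lambda>)"
proof -
  have "\<exists>N. N > 0 \<and> int N *s axis i 1 \<in> \<Lambda>" for i using multiple_mem[of "axis i 1"] by blast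
  then obtain N where N: "\<And>i. N i > 0" "\<And>i. int (N i) *s axis i 1 \<in> \<Lambda>" by metis
  have "(z $ i) ^ N i = 1" if z: "z \<in> annihilator \<Lambda>" for z i
  proof -
    have "char_on UNIV (monom_val z)"
      unfolding char_on_def using norm_monom_val monom_val_add annihilator_norm[OF z] by blast
    then have "monom_val z (int (N i) *s axis i 1) = z $ i powi int (N i)"
      using char_on_scale[of UNIV "monom_val z" "axis i 1"] by (simp add: monom_val_axis)
    then show ?thesis using z N(2)[of i] by (simp add: annihilator_def)
  qed
  then have "vec_nth ` annihilator \<Lambda> \<subseteq> PiE UNIV (\<lambda>i. {w. w ^ N i = 1})" by auto
  moreover have "finite (PiE UNIV (\<lambda>i. {w::complex. w ^ N i = 1}))"
    by (rule finite_PiE) (use N in \<open>auto intro!: finite_nth_roots\<close>)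
  ultimately show ?thesis
    by (metis finite_subset finite_imageD inj_onI vec_nth_inject)
qed

lemma one_annihilator: "(\<chi> i. 1) \<in> annihilator \<Lambda>"
  by (simp add: annihilator_def monom_val_def)

lemma mult_annihilator:
  "z \<in> annihilator \<Lambda> \<Longrightarrow> w \<in> annihilator \<Lambda> \<Longrightarrow> (\<chi> i. z $ i * w $ i) \<in> annihilator \<Lambda>"
  by (simp add: annihilator_def monom_val_mult norm_mult)

lemma inverse_annihilator:
  "z \<in> annihilator \<Lambda> \<Longrightarrow> (\<chi> i. inverse (z $ i)) \<in> annihilator \<Lambda>"
  by (simp add: annihilator_def monom_val_inverse norm_inverse)

text \<open>
  If \<open>z\<close> has a coordinate other than \<open>1\<close>, translation by the unit vector in that direction permutes
  the cosets and multiplies the sum by this coordinate.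
\<close>

lemma sum_rep_monom_val:
  assumes z: "z \<in> annihilator \<Lambda>"
  shows "(\<Sum>a<m. monom_val z (rep a)) = (if z = (\<chi> i. 1) then of_nat m else 0)"
proof (cases "z = (\<chi> i. 1)")
  case True
  then show ?thesis by (simp add: monom_val_def)
next
  case False
  then obtain i where "z $ i \<noteq> 1" by (auto simp: vec_eq_iff)
  then have i: "monom_val z (axis i 1) \<noteq> 1" by (simp add: monom_val_axis)
  let ?f = "\<lambda>a. cls (rep a + axis i 1)"
  have inj: "inj_on ?f {..<m}"
  proof (rule inj_onI)
    fix a b assume ab: "a \<in> {..<m}" "b \<in> {..<m}" "?f a = ?f b"
    then have "cls (rep a) = cls (rep b)" unfolding cls_eq_iff by simp
    then show "a = b" using ab by (simp add: cls_rep)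
  qed
  have "?f ` {..<m} = {..<m}"
    by (rule endo_inj_surj) (use inj cls_less in auto)
  then have "(\<Sum>a<m. monom_val z (rep a)) = (\<Sum>a<m. monom_val z (rep (?f a)))"
    using sum.reindex[OF inj, of "\<lambda>a. monom_val z (rep a)"] by (simp add: o_def)
  also have "\<dots> = (\<Sum>a<m. monom_val z (rep a) * monom_val z (axis i 1))"
  proof (rule sum.cong)
    fix a assume "a \<in> {..<m}"
    have "monom_val z (rep (?f a)) = monom_val z (rep a + axis i 1)"
      by (rule monom_val_cong[OF z]) (simp add: cls_rep cls_less)
    then show "monom_val z (rep (?f a)) = monom_val z (rep a) * monom_val z (axis i 1)"
      by (simp add: monom_val_add[OF annihilator_norm[OF z]])
  qed simp
  also have "\<dots> = (\<Sum>a<m. monom_val z (rep a)) * monom_val z (axis i 1)"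
    by (simp add: sum_distrib_right)
  finally show ?thesis using i False by simp
qed

text \<open>
  For a point \<open>w\<close> of the annihilator with \<open>w\<^sup>n \<noteq> 1\<close>, multiplication by \<open>w\<close> permutes the annihilator and
  multiplies the sum by \<open>w\<^sup>n\<close>.
\<close>

lemma sum_annihilator_monom_val:
  assumes "n \<notin> \<Lambda>"
  shows "(\<Sum>z\<in>annihilator \<Lambda>. monom_val z n) = 0"
proof -
  obtain w where w: "w \<in> annihilator \<Lambda>" "monom_val w n \<noteq> 1" using annihilator_separates[OF assms] .
  have w0: "w $ i \<noteq> 0" for i using annihilator_norm[OF w(1)] by (metis norm_zero zero_neq_one)
  let ?f = "\<lambda>z. \<chi> i. z $ i * w $ i"
  have inj: "inj_on ?f (annihilator \<Lambda>)"
    using w0 by (auto simp: inj_on_def vec_eq_iff)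
  have "?f ` annihilator \<Lambda> = annihilator \<Lambda>"
    by (rule endo_inj_surj) (use inj finite_annihilator mult_annihilator[OF _ w(1)] in auto)
  then have "(\<Sum>z\<in>annihilator \<Lambda>. monom_val z n) = (\<Sum>z\<in>annihilator \<Lambda>. monom_val (?f z) n)"
    using sum.reindex[OF inj, of "\<lambda>z. monom_val z n"] by (simp add: o_def)
  also have "\<dots> = (\<Sum>z\<in>annihilator \<Lambda>. monom_val z n) * monom_val w n"
    by (simp add: monom_val_mult sum_distrib_right)
  finally show ?thesis using w(2) by simp
qed

text \<open>
  Sum \<open>z\<^sup>n\<close> over all \<open>z\<close> in the annihilator and all cosets of \<open>n\<close>. Summing over the cosets first, only
  \<open>z = 1\<close> contributes, with \<open>m\<close>; summing over \<open>z\<close> first, only the coset \<open>\<Lambda>\<close> contributes, with the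
  number of points of the annihilator.
\<close>

theorem card_annihilator: "card (annihilator \<Lambda>) = m"
proof -
  have "of_nat m = (\<Sum>z\<in>annihilator \<Lambda>. \<Sum>a<m. monom_val z (rep a))"
    using finite_annihilator one_annihilator by (simp add: sum_rep_monom_val)
  also have "\<dots> = (\<Sum>a<m. \<Sum>z\<in>annihilator \<Lambda>. monom_val z (rep a))" by (rule sum.swap)
  also have "\<dots> = (\<Sum>a<m. if a = cls 0 then of_nat (card (annihilator \<Lambda>)) else 0)"
  proof (rule sum.cong)
    fix a assume a: "a \<in> {..<m}"
    show "(\<Sum>z\<in>annihilator \<Lambda>. monom_val z (rep a)) = (if a = cls 0 then of_nat (card (annihilator \<Lambda>)) else 0)"
    proof (cases "rep a \<in> \<Lambda>")
      case True
      then have "cls (rep a) = cls 0" by (simp add: cls_eq_iff)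
      then show ?thesis using a True by (simp add: cls_rep annihilator_def)
    next
      case False
      then have "cls (rep a) \<noteq> cls 0" by (simp add: cls_eq_iff)
      then show ?thesis using a by (simp add: cls_rep sum_annihilator_monom_val[OF False])
    qed
  qed simp
  also have "\<dots> = of_nat (card (annihilator \<Lambda>))" using cls_less[of 0] by simp
  finally show ?thesis by (metis of_nat_eq_iff)
qed

lemma annihilator_orthogonal:
  assumes "z \<in> annihilator \<Lambda>" "w \<in> annihilator \<Lambda>"
  shows "(\<Sum>a<m. inverse (monom_val z (rep a)) * monom_val w (rep a)) = (if z = w then of_nat m else 0)"
proof -
  have nz: "z $ i \<noteq> 0" for i using annihilator_norm[OF assms(1)] by (metis norm_zero zero_neq_one)
  have "(\<Sum>a<m. inverse (monom_val z (rep a)) * monom_val w (rep a)) =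
      (\<Sum>a<m. monom_val (\<chi> i. (\<chi> i. inverse (z $ i)) $ i * w $ i) (rep a))"
    unfolding monom_val_mult monom_val_inverse ..
  also have "\<dots> = (if (\<chi> i. (\<chi> i. inverse (z $ i)) $ i * w $ i) = (\<chi> i. 1) then of_nat m else 0)"
    by (rule sum_rep_monom_val[OF mult_annihilator[OF inverse_annihilator[OF assms(1)] assms(2)]])
  also have "(\<chi> i. (\<chi> i. inverse (z $ i)) $ i * w $ i) = (\<chi> i. 1) \<longleftrightarrow> z = w"
    using nz by (auto simp: vec_eq_iff field_simps)
  finally show ?thesis .
qed

end

lemma full_lattice_finite_index:
  fixes \<Lambda> :: "(int ^ 'd::finite) set"
  assumes "full_lattice \<Lambda>"
  obtains m cls rep where "finite_index \<Lambda> m cls rep"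
proof -
  have sub: "subgroup \<Lambda> Zd_group" and fin: "finite (rcosets\<^bsub>Zd_group\<^esub> \<Lambda>)"
    using assms by (auto simp: full_lattice_def)
  have grp: "group (Zd_group :: (int ^ 'd) monoid)"
    by (rule groupI) (auto simp: Zd_group_def algebra_simps intro: exI[of _ "- x" for x])
  have inv: "inv\<^bsub>Zd_group\<^esub> x = - x" for x :: "int ^ 'd"
    by (rule group.inv_equality[OF grp]) (auto simp: Zd_group_def)
  have 0: "0 \<in> \<Lambda>" using subgroup.one_closed[OF sub] by (simp add: Zd_group_def)
  have add: "x + y \<in> \<Lambda>" if "x \<in> \<Lambda>" "y \<in> \<Lambda>" for x y
    using subgroup.m_closed[OF sub that] by (simp add: Zd_group_def)
  have neg: "- x \<in> \<Lambda>" if "x \<in> \<Lambda>" for x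
    using subgroup.m_inv_closed[OF sub that] by (simp add: inv)
  have diff: "x - y \<in> \<Lambda>" if "x \<in> \<Lambda>" "y \<in> \<Lambda>" for x y
    using add[OF that(1) neg[OF that(2)]] by simp
  define K where "K x = (\<lambda>h. h + x) ` \<Lambda>" for x
  have K: "rcosets\<^bsub>Zd_group\<^esub> \<Lambda> = range K"
    unfolding RCOSETS_def r_coset_def K_def by (auto simp: Zd_group_def)
  have Keq: "K x = K y \<longleftrightarrow> x - y \<in> \<Lambda>" for x y
  proof
    assume "K x = K y"
    moreover have "x \<in> K x" unfolding K_def using 0 by (auto intro!: image_eqI[of _ _ 0])
    ultimately obtain h where "h \<in> \<Lambda>" "x = h + y" unfolding K_def by blast
    then show "x - y \<in> \<Lambda>" by simp
  next
    have "K x \<subseteq> K y" if "x - y \<in> \<Lambda>" for x y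
      unfolding K_def using add[OF _ that] by (auto simp: algebra_simps intro!: image_eqI[of _ _ "h + (x - y)" for h])
    moreover assume "x - y \<in> \<Lambda>"
    moreover from this have "y - x \<in> \<Lambda>" using neg by fastforce
    ultimately show "K x = K y" by blast
  qed
  obtain h where h: "bij_betw h (range K) {0..<card (range K)}"
    using ex_bij_betw_finite_nat fin K by metis
  define m where "m = card (range K)"
  define cls where "cls x = h (K x)" for x
  define rep where "rep a = (SOME x. cls x = a)" for a
  have "finite_index \<Lambda> m cls rep"
  proof
    show "cls x < m" for x using bij_betwE[OF h] unfolding cls_def m_def by auto
    show "cls x = cls y \<longleftrightarrow> x - y \<in> \<Lambda>" for x y
      unfolding cls_def Keq[symmetric] using bij_betw_imp_inj_on[OF h] by (auto simp: inj_on_def)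
    show "cls (rep a) = a" if a: "a < m" for a
    proof -
      have "a \<in> h ` range K" using bij_betw_imp_surj_on[OF h] a by (simp add: m_def)
      then have "\<exists>x. cls x = a" unfolding cls_def by auto
      then show ?thesis unfolding rep_def by (rule someI_ex)
    qed
  qed (use 0 diff in auto)
  then show ?thesis using that by blast
qed

section \<open>Evaluation of Laurent polynomials and block diagonal determinants\<close>

lemma laurent_val_superset:
  assumes "finite S" "Poly_Mapping.keys f \<subseteq> S"
  shows "laurent_val f z = (\<Sum>n\<in>S. of_int (Poly_Mapping.lookup f n) * monom_val z n)"
  unfolding laurent_val_def
  by (rule sum.mono_neutral_left) (use assms in \<open>auto simp: in_keys_iff\<close>)

lemma laurent_val_0 [simp]: "laurent_val 0 z = 0"
  by (simp add: laurent_val_def)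

lemma laurent_val_diff: "laurent_val (f - g) z = laurent_val f z - laurent_val g z"
proof -
  let ?S = "Poly_Mapping.keys f \<union> Poly_Mapping.keys g"
  have "laurent_val h z = (\<Sum>n\<in>?S. of_int (Poly_Mapping.lookup h n) * monom_val z n)"
    if "h \<in> {f, g, f - g}" for h
    by (rule laurent_val_superset) (use that keys_diff[of f g] in auto)
  then show ?thesis by (simp add: lookup_minus algebra_simps sum_subtractf)
qed

lemma laurent_val_uminus: "laurent_val (- f) z = - laurent_val f z"
  using laurent_val_diff[of 0 f z] by simp

lemma laurent_val_add: "laurent_val (f + g) z = laurent_val f z + laurent_val g z"
  using laurent_val_diff[of f "- g" z] by (simp add: laurent_val_uminus)

lemma laurent_val_frag_of [simp]: "laurent_val (frag_of n) z = monom_val z n"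
  by (simp add: laurent_val_def)

lemma laurent_val_mult:
  assumes z: "\<forall>i. cmod (z $ i) = 1"
  shows "laurent_val (f * g) z = laurent_val f z * laurent_val g z"
proof -
  have mono: "laurent_val (frag_of n * g) z = monom_val z n * laurent_val g z" for n g
    by (induction g rule: frag_induction[OF subset_UNIV])
      (simp_all add: mult_single monom_val_add[OF z] right_diff_distrib laurent_val_diff)
  show ?thesis
    by (induction f rule: frag_induction[OF subset_UNIV])
      (simp_all add: mono left_diff_distrib laurent_val_diff)
qed

lemma laurent_val_1 [simp]: "laurent_val 1 z = 1"
  using laurent_val_frag_of[of 0 z] by simp

lemma laurent_val_sum: "laurent_val (sum f S) z = (\<Sum>x\<in>S. laurent_val (f x) z)"
  by (induction S rule: infinite_finite_induct) (simp_all add: laurent_val_add)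

lemma laurent_val_prod:
  "\<forall>i. cmod (z $ i) = 1 \<Longrightarrow> laurent_val (prod f S) z = (\<Prod>x\<in>S. laurent_val (f x) z)"
  by (induction S rule: infinite_finite_induct) (simp_all add: laurent_val_mult)

text \<open>
  Evaluation at a point of the torus is a ring homomorphism, so it commutes with the determinant.
\<close>

lemma laurent_val_det:
  fixes A :: "'d::finite laurent ^ 'k ^ 'k"
  assumes "\<forall>i. cmod (z $ i) = 1"
  shows "laurent_val (Determinants.det A) z = Determinants.det (\<chi> i j. laurent_val (A $ i $ j) z)"
proof -
  have "laurent_val (of_int (sign p) * f) z = of_int (sign p) * laurent_val f z" for p :: "'k \<Rightarrow> 'k" and f
    by (cases p rule: sign_cases) (simp_all add: laurent_val_uminus)
  then show ?thesis
    unfolding Determinants.det_def by (simp add: laurent_val_sum laurent_val_prod[OF assms])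
qed

lemma det_eq_det_mat:
  fixes A :: "'a::comm_ring_1 ^ 'k ^ 'k"
  assumes f: "bij_betw f {0..<k} (UNIV :: 'k set)"
  shows "Determinants.det A = Determinant.det (mat k k (\<lambda>(a, b). A $ f a $ f b))"
proof -
  let ?S = "{0..<k}" and ?g = "inv_into {0..<k} f"
  have g: "bij_betw ?g UNIV ?S" by (rule bij_betw_inv_into[OF f])
  have inj: "inj_on f ?S" using f by (rule bij_betw_imp_inj_on)
  have "bij_betw (map_permutation ?S f) {q. q permutes ?S} {p. p permutes UNIV}"
  proof (rule bij_betw_byWitness[where f' = "map_permutation UNIV ?g"])
    show "\<forall>q\<in>{q. q permutes ?S}. map_permutation UNIV ?g (map_permutation ?S f q) = q"
      using map_permutation_compose_inv[OF f] inj by auto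
    show "\<forall>p\<in>{p. p permutes UNIV}. map_permutation ?S f (map_permutation UNIV ?g p) = p"
      using map_permutation_compose_inv[OF g] f by (auto simp: bij_betw_inv_into_right[OF f])
    show "map_permutation ?S f ` {q. q permutes ?S} \<subseteq> {p. p permutes UNIV}"
      using map_permutation_permutes[OF f] by auto
    show "map_permutation UNIV ?g ` {p. p permutes UNIV} \<subseteq> {q. q permutes ?S}"
      using map_permutation_permutes[OF g] by auto
  qed
  then have "Determinants.det A = (\<Sum>q | q permutes ?S. of_int (sign (map_permutation ?S f q)) *
      (\<Prod>i\<in>UNIV. A $ i $ map_permutation ?S f q i))"
    unfolding Determinants.det_def by (rule sum.reindex_bij_betw[symmetric])
  also have "\<dots> = (\<Sum>q | q permutes ?S. of_int (sign q) * (\<Prod>a\<in>?S. A $ f a $ f (q a)))"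
  proof (rule sum.cong[OF refl])
    fix q assume q: "q \<in> {q. q permutes ?S}"
    have "(\<Prod>i\<in>UNIV. A $ i $ map_permutation ?S f q i) = (\<Prod>a\<in>?S. A $ f a $ map_permutation ?S f q (f a))"
      by (rule prod.reindex_bij_betw[OF f, symmetric])
    also have "\<dots> = (\<Prod>a\<in>?S. A $ f a $ f (q a))"
      by (rule prod.cong) (use inj in \<open>auto simp: map_permutation_apply\<close>)
    finally show "of_int (sign (map_permutation ?S f q)) * (\<Prod>i\<in>UNIV. A $ i $ map_permutation ?S f q i) =
        of_int (sign q) * (\<Prod>a\<in>?S. A $ f a $ f (q a))"
      using sign_map_permutation[OF inj, of q] q by simp
  qed
  also have "\<dots> = Determinant.det (mat k k (\<lambda>(a, b). A $ f a $ f b))"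
    unfolding Determinant.det_def
    by (auto intro!: sum.cong prod.cong simp: permutes_in_image dest: permutes_in_image)
  finally show ?thesis .
qed

lemma det_block_diagonal:
  fixes M :: "nat \<Rightarrow> nat \<Rightarrow> nat \<Rightarrow> 'a::idom"
  assumes k: "k > 0"
  shows "Determinant.det (mat (m * k) (m * k)
      (\<lambda>(r, c). if r div k = c div k then M (r div k) (r mod k) (c mod k) else 0)) =
    (\<Prod>a<m. Determinant.det (mat k k (\<lambda>(i, j). M a i j)))"
proof (induction m)
  case 0
  show ?case by (simp add: Determinant.det_def)
next
  case (Suc m)
  let ?D = "\<lambda>m. mat (m * k) (m * k)
      (\<lambda>(r, c). if r div k = c div k then M (r div k) (r mod k) (c mod k) else 0)"
  have low: "r div k < m" if "r < m * k" for r using that k by (simp add: less_mult_imp_div_less)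
  have high: "r div k = m \<and> r mod k = r - m * k" if "\<not> r < m * k" "r < m * k + k" for r
  proof -
    have "r = m * k + (r - m * k)" "r - m * k < k" using that by auto
    then show ?thesis by (metis div_mult_self3 k div_less mod_mult_self3 mod_less add_0_right less_not_refl)
  qed
  have "?D (Suc m) = four_block_mat (?D m) (0\<^sub>m (m * k) k) (0\<^sub>m k (m * k)) (mat k k (\<lambda>(i, j). M m i j))"
  proof (rule eq_matI)
    fix r c assume "r < dim_row (four_block_mat (?D m) (0\<^sub>m (m * k) k) (0\<^sub>m k (m * k)) (mat k k (\<lambda>(i, j). M m i j)))"
      "c < dim_col (four_block_mat (?D m) (0\<^sub>m (m * k) k) (0\<^sub>m k (m * k)) (mat k k (\<lambda>(i, j). M m i j)))"
    then have rc: "r < m * k + k" "c < m * k + k" by auto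
    then show "?D (Suc m) $$ (r, c) = four_block_mat (?D m) (0\<^sub>m (m * k) k) (0\<^sub>m k (m * k)) (mat k k (\<lambda>(i, j). M m i j)) $$ (r, c)"
    proof (cases "r < m * k")
      case r: True
      show ?thesis
      proof (cases "c < m * k")
        case True
        then show ?thesis using r rc by simp
      next
        case False
        then have "r div k \<noteq> c div k" using low[OF r] high[OF False rc(2)] by simp
        then show ?thesis using r rc False by simp
      qed
    next
      case r: False
      show ?thesis
      proof (cases "c < m * k")
        case True
        then have "r div k \<noteq> c div k" using low[OF True] high[OF r rc(1)] by simp
        then show ?thesis using r rc True by simp
      next
        case False
        have "r - m * k < k" "c - m * k < k" using r False rc by auto
        then show ?thesis using r rc False high[OF r rc(1)] high[OF False rc(2)] by simp
      qed
    qed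
  qed auto
  then have "Determinant.det (?D (Suc m)) = Determinant.det (?D m) * Determinant.det (mat k k (\<lambda>(i, j). M m i j))"
    using det_four_block_mat_lower_left_zero[of "?D m" "m * k" "0\<^sub>m (m * k) k" k "0\<^sub>m k (m * k)" "mat k k (\<lambda>(i, j). M m i j)"]
    by simp
  then show ?case using Suc.IH by simp
qed

section \<open>Fixed characters as periodic configurations\<close>

text \<open>
  The homomorphism from the free abelian group on \<open>'a\<close> to \<open>S\<^sup>1\<close> that extends a map \<open>x\<close> on the
  generators. As additive groups, Laurent polynomials are such a group, with the monomials
  \<open>frag_of n\<close> as generators.
\<close>

definition char_val :: "('a \<Rightarrow> complex) \<Rightarrow> ('a \<Rightarrow>\<^sub>0 int) \<Rightarrow> complex" where
  "char_val x f = (\<Prod>n\<in>Poly_Mapping.keys f. x n powi Poly_Mapping.lookup f n)"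

lemma char_val_superset:
  assumes "finite S" "Poly_Mapping.keys f \<subseteq> S"
  shows "char_val x f = (\<Prod>n\<in>S. x n powi Poly_Mapping.lookup f n)"
  unfolding char_val_def
  by (rule prod.mono_neutral_left) (use assms in \<open>auto simp: in_keys_iff\<close>)

lemma char_val_0 [simp]: "char_val x 0 = 1"
  by (simp add: char_val_def)

lemma char_val_frag_of [simp]: "char_val x (frag_of n) = x n"
  by (simp add: char_val_def)

lemma norm_char_val: "(\<And>n. cmod (x n) = 1) \<Longrightarrow> cmod (char_val x f) = 1"
  by (simp add: char_val_def prod_norm[symmetric] norm_power_int)

lemma char_val_diff:
  assumes "\<And>n. cmod (x n) = 1"
  shows "char_val x (f - g) = char_val x f / char_val x g"
proof -
  let ?S = "Poly_Mapping.keys f \<union> Poly_Mapping.keys g"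
  have nz: "x n \<noteq> 0" for n using assms[of n] by auto
  have "char_val x h = (\<Prod>n\<in>?S. x n powi Poly_Mapping.lookup h n)" if "h \<in> {f, g, f - g}" for h
    by (rule char_val_superset) (use that keys_diff[of f g] in auto)
  then show ?thesis by (simp add: lookup_minus power_int_diff nz prod_dividef)
qed

lemma char_val_add:
  assumes "\<And>n. cmod (x n) = 1"
  shows "char_val x (f + g) = char_val x f * char_val x g"
proof -
  have "char_val x g \<noteq> 0" using norm_char_val[of x g, OF assms] by auto
  then show ?thesis using char_val_diff[of x "f + g" g, OF assms] by (simp add: field_simps)
qed

lemma char_val_shift:
  fixes x :: "int ^ 'd::finite \<Rightarrow> complex"
  assumes "\<And>n. cmod (x n) = 1"
  shows "char_val x (f * frag_of k) = char_val (\<lambda>n. x (n + k)) f"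
  by (induction f rule: frag_induction[OF subset_UNIV])
    (simp_all add: mult_single left_diff_distrib char_val_diff assms)

lemma char_val_unique:
  assumes "\<And>f g. \<phi> (f + g) = \<phi> f * (\<phi> g :: complex)" "\<And>f. cmod (\<phi> f) = 1"
  shows "\<phi> f = char_val (\<lambda>n. \<phi> (frag_of n)) f"
proof (induction f rule: frag_induction[OF subset_UNIV])
  case 1
  have "\<phi> 0 = \<phi> 0 * \<phi> 0" using assms(1)[of 0 0] by simp
  then show ?case using assms(2)[of 0] by auto
next
  case (3 a b)
  have "\<phi> b \<noteq> 0" using assms(2)[of b] by auto
  moreover have "\<phi> a = \<phi> (a - b) * \<phi> b" using assms(1)[of "a - b" b] by simp
  ultimately have "\<phi> (a - b) = \<phi> a / \<phi> b" by simp
  then show ?case using 3 by (simp add: char_val_diff assms(2))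
qed simp

definition coset :: "'a::comm_ring_1 ^ 'k ^ 'k \<Rightarrow> 'a ^ 'k \<Rightarrow> ('a ^ 'k) set" where
  "coset A x = (\<lambda>h. h + x) ` range (\<lambda>v. A *v v)"

lemma coset_eq_iff: "coset A x = coset A y \<longleftrightarrow> x - y \<in> range (\<lambda>v. A *v v)"
proof
  assume "coset A x = coset A y"
  moreover have "x \<in> coset A x" unfolding coset_def
    by (rule image_eqI[of _ _ 0]) (auto intro!: image_eqI[of _ _ 0])
  ultimately obtain v where "x = A *v v + y" unfolding coset_def by auto
  then show "x - y \<in> range (\<lambda>v. A *v v)" by simp
next
  have "coset A x \<subseteq> coset A y" if "x - y = A *v w" for x y w
  proof
    fix u assume "u \<in> coset A x"
    then obtain v where "u = A *v v + x" unfolding coset_def by auto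
    also have "\<dots> = A *v (v + w) + y"
      using that by (simp add: matrix_vector_right_distrib algebra_simps)
    finally show "u \<in> coset A y" unfolding coset_def by blast
  qed
  moreover assume "x - y \<in> range (\<lambda>v. A *v v)"
  then obtain w where w: "x - y = A *v w" by blast
  moreover from w have "y - x = A *v (0 - w)"
    unfolding matrix_vector_mult_diff_distrib by (simp add: algebra_simps)
  ultimately show "coset A x = coset A y" by blast
qed

lemma r_coset_free_module:
  "range (\<lambda>v. A *v v) +>\<^bsub>free_module\<^esub> x = coset A x"
  by (simp add: coset_def a_r_coset_def r_coset_def free_module_def UNION_singleton_eq_range)

lemma cokernel_carrier:
  fixes A :: "'a::comm_ring_1 ^ 'k ^ 'k"
  shows "carrier (cokernel_module A) = range (coset A)"
  by (simp add: cokernel_module_def quotient_module_def A_RCOSETS_def RCOSETS_def r_coset_def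
    coset_def[abs_def] free_module_def UNION_singleton_eq_range)

lemma cokernel_add: "coset A x \<oplus>\<^bsub>cokernel_module A\<^esub> coset A y = coset A (x + y)"
proof -
  have "coset A x \<oplus>\<^bsub>cokernel_module A\<^esub> coset A y = (\<Union>h\<in>coset A x. \<Union>k\<in>coset A y. {h + k})"
    by (simp add: cokernel_module_def quotient_module_def set_add_def set_mult_def free_module_def)
  also have "\<dots> = coset A (x + y)"
  proof (intro equalityI subsetI)
    fix u assume "u \<in> (\<Union>h\<in>coset A x. \<Union>k\<in>coset A y. {h + k})"
    then obtain v w where "u = (A *v v + x) + (A *v w + y)" unfolding coset_def by auto
    also have "\<dots> = A *v (v + w) + (x + y)" by (simp add: matrix_vector_right_distrib algebra_simps)
    finally show "u \<in> coset A (x + y)" unfolding coset_def by blast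
  next
    fix u assume "u \<in> coset A (x + y)"
    then obtain v where "u = A *v v + (x + y)" unfolding coset_def by auto
    then have "u = (A *v v + x) + (A *v 0 + y)" by (simp add: algebra_simps)
    then show "u \<in> (\<Union>h\<in>coset A x. \<Union>k\<in>coset A y. {h + k})" unfolding coset_def by blast
  qed
  finally show ?thesis .
qed

lemma matrix_vector_mult_smult:
  fixes A :: "'a::comm_ring_1 ^ 'k ^ 'm"
  shows "A *v (r *s v) = r *s (A *v v)"
  by (simp add: vec_eq_iff matrix_vector_mult_def sum_distrib_left mult.left_commute)

lemma cokernel_smult: "r \<odot>\<^bsub>cokernel_module A\<^esub> coset A x = coset A (r *s x)"
proof -
  have "r \<odot>\<^bsub>cokernel_module A\<^esub> coset A x = (\<Union>y\<in>coset A x. coset A (r *s y))"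
    unfolding cokernel_module_def quotient_module_def by (simp add: r_coset_free_module) (simp add: free_module_def)
  also have "\<dots> = coset A (r *s x)"
  proof -
    have "coset A (r *s y) = coset A (r *s x)" if "y \<in> coset A x" for y
    proof -
      obtain v where "y = A *v v + x" using \<open>y \<in> coset A x\<close> unfolding coset_def by auto
      then have "r *s y - r *s x = A *v (r *s v)"
        by (simp add: vector_add_ldistrib matrix_vector_mult_smult)
      then show ?thesis unfolding coset_eq_iff by blast
    qed
    moreover have "x \<in> coset A x" unfolding coset_def
      by (rule image_eqI[of _ _ 0]) (auto intro!: image_eqI[of _ _ 0])
    ultimately show ?thesis by blast
  qed
  finally show ?thesis .
qed

text \<open>
  The fixed points of \<open>\<Lambda>\<close>, as homomorphisms on \<open>R\<^sup>k\<close> instead of its quotient.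
\<close>

definition lifted_fix :: "('d::finite laurent) ^ 'k ^ 'k \<Rightarrow> (int ^ 'd) set \<Rightarrow> ('d laurent ^ 'k \<Rightarrow> complex) set" where
  "lifted_fix A \<Lambda> = {\<phi>. (\<forall>v. cmod (\<phi> v) = 1) \<and> (\<forall>v w. \<phi> (v + w) = \<phi> v * \<phi> w) \<and>
     (\<forall>v. \<phi> (A *v v) = 1) \<and> (\<forall>n\<in>\<Lambda>. \<forall>v. \<phi> (monomial n *s v) = \<phi> v)}"

lemma Fix_points_cokernel:
  "Fix_points (carrier (dual_space (cokernel_module A))) (dual_action (cokernel_module A)) \<Lambda> =
   {\<theta> \<in> extensional (range (coset A)). (\<forall>v. cmod (\<theta> (coset A v)) = 1) \<and>
     (\<forall>v w. \<theta> (coset A (v + w)) = \<theta> (coset A v) * \<theta> (coset A w)) \<and>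
     (\<forall>n\<in>\<Lambda>. \<forall>v. \<theta> (coset A (monomial n *s v)) = \<theta> (coset A v))}"
proof -
  have "dual_action (cokernel_module A) n \<theta> = \<theta> \<longleftrightarrow> (\<forall>v. \<theta> (coset A (monomial n *s v)) = \<theta> (coset A v))"
    if "\<theta> \<in> extensional (range (coset A))" for \<theta> n
  proof
    assume eq: "dual_action (cokernel_module A) n \<theta> = \<theta>"
    show "\<forall>v. \<theta> (coset A (monomial n *s v)) = \<theta> (coset A v)"
    proof
      fix v
      show "\<theta> (coset A (monomial n *s v)) = \<theta> (coset A v)"
        using fun_cong[OF eq, of "coset A v"]
        by (simp add: dual_action_def dual_map_def cokernel_carrier cokernel_smult)
    qed
  next
    assume eq: "\<forall>v. \<theta> (coset A (monomial n *s v)) = \<theta> (coset A v)"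
    show "dual_action (cokernel_module A) n \<theta> = \<theta>"
      by (rule extensionalityI[of _ "range (coset A)"])
        (use eq that in \<open>auto simp: dual_action_def dual_map_def cokernel_carrier cokernel_smult\<close>)
  qed
  moreover have "carrier (dual_space (cokernel_module A)) =
    {\<theta> \<in> extensional (range (coset A)). (\<forall>v. cmod (\<theta> (coset A v)) = 1) \<and>
     (\<forall>v w. \<theta> (coset A (v + w)) = \<theta> (coset A v) * \<theta> (coset A w))}"
    unfolding dual_space_def pontryagin_dual_def hom_def circle_group_def
    by (auto simp: cokernel_carrier cokernel_add)
  ultimately show ?thesis unfolding Fix_points_def by auto
qed

lemma bij_betw_Fix_points_lifted_fix:
  "bij_betw (\<lambda>\<theta> v. \<theta> (coset A v))
     (Fix_points (carrier (dual_space (cokernel_module A))) (dual_action (cokernel_module A)) \<Lambda>)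
     (lifted_fix A \<Lambda>)"
  unfolding Fix_points_cokernel
proof (rule bij_betwI')
  let ?F = "{\<theta> \<in> extensional (range (coset A)). (\<forall>v. cmod (\<theta> (coset A v)) = 1) \<and>
     (\<forall>v w. \<theta> (coset A (v + w)) = \<theta> (coset A v) * \<theta> (coset A w)) \<and>
     (\<forall>n\<in>\<Lambda>. \<forall>v. \<theta> (coset A (monomial n *s v)) = \<theta> (coset A v))}"
  fix \<theta> assume \<theta>: "\<theta> \<in> ?F"
  show "((\<lambda>v. \<theta> (coset A v)) = (\<lambda>v. \<psi> (coset A v))) = (\<theta> = \<psi>)" if \<psi>: "\<psi> \<in> ?F" for \<psi>
  proof
    assume eq: "(\<lambda>v. \<theta> (coset A v)) = (\<lambda>v. \<psi> (coset A v))"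
    show "\<theta> = \<psi>"
      by (rule extensionalityI[of _ "range (coset A)"]) (use \<theta> \<psi> fun_cong[OF eq] in auto)
  qed simp
  have "\<theta> (coset A (A *v v)) = 1" for v
  proof -
    have "coset A (A *v v) = coset A 0" by (simp add: coset_eq_iff)
    moreover have "\<theta> (coset A (0 + 0)) = \<theta> (coset A 0) * \<theta> (coset A 0)" using \<theta> by blast
    moreover have "cmod (\<theta> (coset A 0)) = 1" using \<theta> by blast
    ultimately show ?thesis by auto
  qed
  then show "(\<lambda>v. \<theta> (coset A v)) \<in> lifted_fix A \<Lambda>" using \<theta> unfolding lifted_fix_def by auto
next
  fix \<phi> assume "\<phi> \<in> lifted_fix A \<Lambda>"
  note \<phi> = this[unfolded lifted_fix_def mem_Collect_eq]
  define \<theta> where "\<theta> = (\<lambda>C\<in>range (coset A). \<phi> (SOME v. coset A v = C))"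
  have \<theta>: "\<theta> (coset A v) = \<phi> v" for v
  proof -
    define w where "w = (SOME w. coset A w = coset A v)"
    have "coset A w = coset A v" unfolding w_def by (rule someI[of "\<lambda>w. coset A w = coset A v" v]) simp
    then obtain u where "w - v = A *v u" unfolding coset_eq_iff by blast
    then have "w = A *v u + v" by (simp add: algebra_simps)
    then have "\<phi> w = \<phi> v" using \<phi> by simp
    then show ?thesis unfolding \<theta>_def w_def by simp
  qed
  have "\<theta> \<in> extensional (range (coset A))" unfolding \<theta>_def by simp
  then show "\<exists>\<theta>\<in>{\<theta> \<in> extensional (range (coset A)). (\<forall>v. cmod (\<theta> (coset A v)) = 1) \<and>
     (\<forall>v w. \<theta> (coset A (v + w)) = \<theta> (coset A v) * \<theta> (coset A w)) \<and>
     (\<forall>n\<in>\<Lambda>. \<forall>v. \<theta> (coset A (monomial n *s v)) = \<theta> (coset A v))}. \<phi> = (\<lambda>v. \<theta> (coset A v))"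
    using \<phi> by (intro bexI[of _ \<theta>]) (auto simp: \<theta>)
qed

text \<open>
  The fixed points of \<open>\<Lambda>\<close>, as configurations: \<open>x n i\<close> is the value of a character at \<open>u\<^sup>n e\<^sub>i\<close>, and the
  last condition says that the character is trivial at \<open>u\<^sup>n A e\<^sub>j\<close>.
\<close>

definition config_fix :: "('d::finite laurent) ^ 'k ^ 'k \<Rightarrow> (int ^ 'd) set \<Rightarrow> (int ^ 'd \<Rightarrow> 'k \<Rightarrow> complex) set" where
  "config_fix A \<Lambda> = {x. (\<forall>n i. cmod (x n i) = 1) \<and> (\<forall>k\<in>\<Lambda>. \<forall>n i. x (n + k) i = x n i) \<and>
     (\<forall>n j. (\<Prod>i\<in>UNIV. char_val (\<lambda>m. x (m + n) i) (A $ i $ j)) = 1)}"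

lemma matrix_vector_mult_axis:
  fixes A :: "'a::comm_ring_1 ^ 'k ^ 'k"
  shows "(A *v axis j f) $ i = A $ i $ j * f"
proof -
  have "(A *v axis j f) $ i = (\<Sum>l\<in>UNIV. A $ i $ l * axis j f $ l)"
    by (simp add: matrix_vector_mult_def)
  also have "\<dots> = (\<Sum>l\<in>UNIV. if l = j then A $ i $ l * f else 0)"
    by (rule sum.cong) (auto simp: axis_def)
  finally show ?thesis by simp
qed

lemma vec_eq_sum_axis: "(v :: 'a::comm_ring_1 ^ 'k) = (\<Sum>i\<in>UNIV. axis i (v $ i))"
  by (simp add: vec_eq_iff axis_def sum_component)

text \<open>
  A homomorphism is determined by its values on the basis \<open>u\<^sup>n e\<^sub>i\<close>, and these values are arbitrary.
  It is trivial on \<open>A R\<^sup>k\<close> as soon as it is trivial on the elements \<open>u\<^sup>n A e\<^sub>j\<close>, which generate that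
  subgroup.
\<close>

lemma bij_betw_lifted_fix_config_fix:
  fixes A :: "('d::finite laurent) ^ 'k ^ 'k"
  shows "bij_betw (\<lambda>\<phi> n i. \<phi> (axis i (frag_of n))) (lifted_fix A \<Lambda>) (config_fix A \<Lambda>)"
proof (rule bij_betw_byWitness[where f' = "\<lambda>x v. \<Prod>i\<in>UNIV. char_val (\<lambda>n. x n i) (v $ i)"])
  let ?f = "\<lambda>(\<phi> :: 'd laurent ^ 'k \<Rightarrow> complex) n i. \<phi> (axis i (frag_of n))"
  let ?g = "\<lambda>(x :: int ^ 'd \<Rightarrow> 'k \<Rightarrow> complex) v. \<Prod>i\<in>UNIV. char_val (\<lambda>n. x n i) (v $ i)"
  have inv: "?g (?f \<phi>) v = \<phi> v" if "\<phi> \<in> lifted_fix A \<Lambda>" for \<phi> v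
  proof -
    note \<phi> = that[unfolded lifted_fix_def mem_Collect_eq]
    have 0: "\<phi> 0 = 1" using \<phi> by (metis matrix_vector_mult_0_right)
    have add: "axis i (f + g) = axis i f + axis i g" for i :: 'k and f g :: "'d laurent"
      by (simp add: vec_eq_iff axis_def)
    have "char_val (\<lambda>n. \<phi> (axis i (frag_of n))) f = \<phi> (axis i f)" for i f
      by (rule char_val_unique[of "\<lambda>f. \<phi> (axis i f)", symmetric]) (use \<phi> in \<open>auto simp: add\<close>)
    then have "?g (?f \<phi>) v = (\<Prod>i\<in>UNIV. \<phi> (axis i (v $ i)))" by simp
    also have "\<dots> = \<phi> (\<Sum>i\<in>S. axis i (v $ i))" if "S = UNIV" for S
    proof -
      have "(\<Prod>i\<in>S. \<phi> (axis i (v $ i))) = \<phi> (\<Sum>i\<in>S. axis i (v $ i))" for S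
        by (induction S rule: infinite_finite_induct) (use \<phi> 0 in auto)
      then show ?thesis using that by simp
    qed
    finally show ?thesis using vec_eq_sum_axis[of v] by simp
  qed
  show "\<forall>\<phi>\<in>lifted_fix A \<Lambda>. ?g (?f \<phi>) = \<phi>" using inv by blast
  show "\<forall>x\<in>config_fix A \<Lambda>. ?f (?g x) = x"
  proof (intro ballI ext)
    fix x :: "int ^ 'd \<Rightarrow> 'k \<Rightarrow> complex" and n i
    have "?f (?g x) n i = (\<Prod>j\<in>UNIV. if j = i then x n j else 1)"
      by (rule prod.cong) (auto simp: axis_def)
    then show "?f (?g x) n i = x n i" by simp
  qed
  show "?f ` lifted_fix A \<Lambda> \<subseteq> config_fix A \<Lambda>"
  proof (rule image_subsetI)
    fix \<phi> assume mem: "\<phi> \<in> lifted_fix A \<Lambda>"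
    note \<phi> = mem[unfolded lifted_fix_def mem_Collect_eq]
    have "\<phi> (axis i (frag_of (n + k))) = \<phi> (axis i (frag_of n))" if "k \<in> \<Lambda>" for k n i
    proof -
      have "axis i (frag_of (n + k)) = monomial k *s axis i (frag_of n)"
        by (simp add: vec_eq_iff axis_def monomial_def mult_single add.commute)
      then show ?thesis using \<phi> that by simp
    qed
    moreover have "(\<Prod>i\<in>UNIV. char_val (\<lambda>m. \<phi> (axis i (frag_of (m + n)))) (A $ i $ j)) = 1" for n j
    proof -
      have "(\<Prod>i\<in>UNIV. char_val (\<lambda>m. \<phi> (axis i (frag_of (m + n)))) (A $ i $ j)) =
        ?g (?f \<phi>) (A *v axis j (frag_of n))"
        by (simp add: matrix_vector_mult_axis char_val_shift \<phi>)
      then show ?thesis using inv[OF mem] \<phi> by simp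
    qed
    ultimately show "?f \<phi> \<in> config_fix A \<Lambda>" using \<phi> unfolding config_fix_def by blast
  qed
  show "?g ` config_fix A \<Lambda> \<subseteq> lifted_fix A \<Lambda>"
  proof (rule image_subsetI)
    fix x assume "x \<in> config_fix A \<Lambda>"
    note x = this[unfolded config_fix_def mem_Collect_eq]
    have norm: "cmod (?g x v) = 1" for v
      using x by (simp add: prod_norm[symmetric] norm_char_val)
    have add: "?g x (v + w) = ?g x v * ?g x w" for v w
      using x by (simp add: char_val_add prod.distrib)
    have axis: "?g x (A *v axis j f) = 1" for j f
    proof (induction f rule: frag_induction[OF subset_UNIV])
      case 1
      then show ?case by (simp add: matrix_vector_mult_axis)
    next
      case (2 n)
      then show ?case using x by (simp add: matrix_vector_mult_axis char_val_shift)
    next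
      case (3 a b)
      then show ?case using x
        by (simp add: matrix_vector_mult_axis right_diff_distrib char_val_diff prod_dividef)
    qed
    have "?g x (A *v (\<Sum>i\<in>S. axis i (v $ i))) = 1" for v and S :: "'k set"
    proof (induction S rule: infinite_finite_induct)
      case (insert i S)
      then have e: "(\<Sum>i\<in>insert i S. axis i (v $ i)) = axis i (v $ i) + (\<Sum>i\<in>S. axis i (v $ i))" by simp
      show ?case unfolding e matrix_vector_right_distrib add axis insert.IH by simp
    qed simp_all
    then have "?g x (A *v v) = 1" for v using vec_eq_sum_axis[of v] by metis
    moreover have "?g x (monomial n *s v) = ?g x v" if "n \<in> \<Lambda>" for n v
      using x that by (simp add: monomial_def mult.commute[of "frag_of n"] char_val_shift)
    ultimately show "?g x \<in> lifted_fix A \<Lambda>" unfolding lifted_fix_def using norm add by blast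
  qed
qed

section \<open>The integer matrix of the period conditions\<close>

text \<open>
  Rows and columns are indexed by pairs of a coset number \<open>a < m\<close> and an index \<open>i\<close> of the matrix
  \<open>A\<close>; the pair is encoded as \<open>a k + f\<^sup>-\<^sup>1 i\<close>, so that all entries with the same coset number are
  contiguous.
\<close>

lemma bij_betw_div_mod:
  fixes m k :: nat
  assumes "bij_betw f {0..<k} (UNIV :: 'k::finite set)"
  shows "bij_betw (\<lambda>c. (c div k, f (c mod k))) {..<m * k} ({..<m} \<times> UNIV)"
proof (rule bij_betw_byWitness[where f' = "\<lambda>(a, i). a * k + inv_into {0..<k} f i"])
  let ?g = "inv_into {0..<k} f"
  have g: "?g i < k" "f (?g i) = i" for i
    using bij_betw_inv_into_right[OF assms, of i] bij_betwE[OF bij_betw_inv_into[OF assms]] by auto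
  have gf: "?g (f b) = b" if "b < k" for b using bij_betw_inv_into_left[OF assms] that by auto
  have k: "k > 0" using g(1) by (metis gr_zeroI less_zeroE)
  show "\<forall>c\<in>{..<m * k}. (case (c div k, f (c mod k)) of (a, i) \<Rightarrow> a * k + ?g i) = c"
    using k by (auto simp: gf)
  show "\<forall>p\<in>{..<m} \<times> UNIV. ((case p of (a, i) \<Rightarrow> a * k + ?g i) div k, f ((case p of (a, i) \<Rightarrow> a * k + ?g i) mod k)) = p"
    using g k by auto
  show "(\<lambda>c. (c div k, f (c mod k))) ` {..<m * k} \<subseteq> {..<m} \<times> UNIV"
    by (auto simp: less_mult_imp_div_less)
  show "(\<lambda>(a, i). a * k + ?g i) ` ({..<m} \<times> UNIV) \<subseteq> {..<m * k}"
  proof clarsimp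
    fix a i assume "a < m"
    then have "(a + 1) * k \<le> m * k" by (intro mult_right_mono) auto
    then show "a * k + ?g i < m * k" using g(1)[of i] by simp
  qed
qed

lemma sum_div_mod:
  fixes m k :: nat
  assumes "bij_betw f {0..<k} (UNIV :: 'k::finite set)"
  shows "(\<Sum>c<m * k. h (c div k) (f (c mod k))) = (\<Sum>a<m. \<Sum>i\<in>UNIV. h a i)"
  using sum.reindex_bij_betw[OF bij_betw_div_mod[OF assms], of "\<lambda>(a, i). h a i" m]
  by (simp add: sum.cartesian_product)

lemma prod_div_mod:
  fixes m k :: nat
  assumes "bij_betw f {0..<k} (UNIV :: 'k::finite set)"
  shows "(\<Prod>c<m * k. h (c div k) (f (c mod k))) = (\<Prod>a<m. \<Prod>i\<in>UNIV. h a i)"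
  using prod.reindex_bij_betw[OF bij_betw_div_mod[OF assms], of "\<lambda>(a, i). h a i" m]
  by (simp add: prod.cartesian_product)

lemma powi_sum: "(x::complex) \<noteq> 0 \<Longrightarrow> x powi (sum f S) = (\<Prod>n\<in>S. x powi f n)"
  by (induction S rule: infinite_finite_induct) (simp_all add: power_int_add)

lemma prod_powi_fibres:
  fixes T :: "nat \<Rightarrow> complex"
  assumes "finite S" "\<And>n. n \<in> S \<Longrightarrow> h n < m" "\<And>b. T b \<noteq> 0"
  shows "(\<Prod>b<m. T b powi (\<Sum>n\<in>S. if h n = b then w n else 0)) = (\<Prod>n\<in>S. T (h n) powi w n)"
proof -
  have "(\<Prod>b<m. T b powi (\<Sum>n\<in>S. if h n = b then w n else 0)) =
      (\<Prod>n\<in>S. \<Prod>b<m. T b powi (if h n = b then w n else 0))"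
    unfolding powi_sum[OF assms(3)] by (rule prod.swap)
  also have "\<dots> = (\<Prod>n\<in>S. T (h n) powi w n)"
  proof (rule prod.cong[OF refl])
    fix n assume n: "n \<in> S"
    have "(\<Prod>b<m. T b powi (if h n = b then w n else 0)) = (\<Prod>b<m. if b = h n then T b powi w n else 1)"
      by (rule prod.cong) auto
    then show "(\<Prod>b<m. T b powi (if h n = b then w n else 0)) = T (h n) powi w n"
      using assms(2)[OF n] by simp
  qed
  finally show ?thesis .
qed

context finite_index
begin

text \<open>
  Row \<open>(a, j)\<close> is the condition imposed by \<open>u\<^sup>n A e\<^sub>j\<close>, where \<open>n\<close> represents the coset \<open>a\<close>. In column
  \<open>(b, i)\<close> it collects the coefficients of the entry \<open>A $ i $ j\<close> that multiply a value of the
  configuration at coset \<open>b\<close>.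
\<close>

definition period_mat :: "nat \<Rightarrow> (nat \<Rightarrow> 'k) \<Rightarrow> 'd laurent ^ 'k ^ 'k \<Rightarrow> int mat" where
  "period_mat k f A = mat (m * k) (m * k) (\<lambda>(r, c).
     \<Sum>n\<in>Poly_Mapping.keys (A $ f (c mod k) $ f (r mod k)).
       if cls (rep (r div k) + n) = c div k then Poly_Mapping.lookup (A $ f (c mod k) $ f (r mod k)) n else 0)"

lemma period_mat_carrier: "period_mat k f A \<in> carrier_mat (m * k) (m * k)"
  by (simp add: period_mat_def)

lemma cls_add_cong: "cls a = cls b \<Longrightarrow> cls (a + n) = cls (b + n)"
  by (simp add: cls_eq_iff)

lemma period_mat_row:
  assumes f: "bij_betw f {0..<k} (UNIV :: 'k::finite set)" and r: "r < m * k" and t: "\<And>c. t c \<noteq> 0"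
  shows "(\<Prod>c<m * k. t c powi (period_mat k f A $$ (r, c))) =
    (\<Prod>i\<in>UNIV. char_val (\<lambda>n. t (cls (rep (r div k) + n) * k + inv_into {0..<k} f i)) (A $ i $ f (r mod k)))"
proof -
  let ?g = "inv_into {0..<k} f" and ?a = "rep (r div k)" and ?j = "f (r mod k)"
  let ?h = "\<lambda>b i. t (b * k + ?g i) powi
     (\<Sum>n\<in>Poly_Mapping.keys (A $ i $ ?j). if cls (?a + n) = b then Poly_Mapping.lookup (A $ i $ ?j) n else 0)"
  have k: "k > 0" using r by (cases k) auto
  have "(\<Prod>c<m * k. t c powi (period_mat k f A $$ (r, c))) = (\<Prod>c<m * k. ?h (c div k) (f (c mod k)))"
  proof (rule prod.cong[OF refl])
    fix c assume c: "c \<in> {..<m * k}"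
    have "?g (f (c mod k)) = c mod k" using bij_betw_inv_into_left[OF f] k by simp
    then show "t c powi (period_mat k f A $$ (r, c)) = ?h (c div k) (f (c mod k))"
      using c r by (simp add: period_mat_def)
  qed
  also have "\<dots> = (\<Prod>b<m. \<Prod>i\<in>UNIV. ?h b i)" by (rule prod_div_mod[OF f])
  also have "\<dots> = (\<Prod>i\<in>UNIV. \<Prod>b<m. ?h b i)" by (rule prod.swap)
  also have "\<dots> = (\<Prod>i\<in>UNIV. char_val (\<lambda>n. t (cls (?a + n) * k + ?g i)) (A $ i $ ?j))"
    unfolding char_val_def
    by (rule prod.cong[OF refl], rule prod_powi_fibres) (simp_all add: cls_less t)
  finally show ?thesis .
qed

lemma bij_betw_config_fix_torus_kernel:
  assumes f: "bij_betw f {0..<k} (UNIV :: 'k::finite set)"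
  shows "bij_betw (\<lambda>x c. if c < m * k then x (rep (c div k)) (f (c mod k)) else 1)
    (config_fix A \<Lambda>) (torus_kernel (m * k) (period_mat k f A))"
proof (rule bij_betw_byWitness[where f' = "\<lambda>t n i. t (cls n * k + inv_into {0..<k} f i)"])
  let ?g = "inv_into {0..<k} f"
  let ?F = "\<lambda>(x :: int ^ 'd \<Rightarrow> 'k \<Rightarrow> complex) c. if c < m * k then x (rep (c div k)) (f (c mod k)) else 1"
  let ?G = "\<lambda>(t :: nat \<Rightarrow> complex) n i. t (cls n * k + ?g i)"
  have g: "?g i < k" "f (?g i) = i" for i
    using bij_betw_inv_into_right[OF f, of i] bij_betwE[OF bij_betw_inv_into[OF f]] by auto
  have gf: "?g (f b) = b" if "b < k" for b using bij_betw_inv_into_left[OF f] that by auto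
  have k: "k > 0" using g(1) by (metis gr_zeroI less_zeroE)
  have bound: "cls n * k + ?g i < m * k" for n i
  proof -
    have "(cls n + 1) * k \<le> m * k" using cls_less[of n] by (intro mult_right_mono) auto
    then show ?thesis using g(1)[of i] by simp
  qed
  have dm: "(cls n * k + ?g i) div k = cls n" "(cls n * k + ?g i) mod k = ?g i" for n i
    using g(1)[of i] by auto
  have periodic: "x n i = x n' i" if x: "x \<in> config_fix A \<Lambda>" and "cls n = cls n'" for x n n' i
  proof -
    have "n - n' \<in> \<Lambda>" using that by (simp add: cls_eq_iff)
    then have "x (n' + (n - n')) i = x n' i" using x unfolding config_fix_def by blast
    then show ?thesis by simp
  qed
  have FG: "?F x (cls n * k + ?g i) = x n i" if "x \<in> config_fix A \<Lambda>" for x n i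
  proof -
    have "x (rep (cls n)) i = x n i" by (rule periodic[OF that]) (simp add: cls_rep cls_less)
    then show ?thesis using bound by (simp add: dm g)
  qed
  then show "\<forall>x\<in>config_fix A \<Lambda>. ?G (?F x) = x" by blast
  show "\<forall>t\<in>torus_kernel (m * k) (period_mat k f A). ?F (?G t) = t"
  proof (intro ballI ext)
    fix t c assume t: "t \<in> torus_kernel (m * k) (period_mat k f A)"
    show "?F (?G t) c = t c"
    proof (cases "c < m * k")
      case True
      then have "cls (rep (c div k)) = c div k" by (simp add: cls_rep less_mult_imp_div_less)
      then show ?thesis using True k by (simp add: gf)
    next
      case False
      then show ?thesis using t by (simp add: torus_kernel_def)
    qed
  qed
  show "?F ` config_fix A \<Lambda> \<subseteq> torus_kernel (m * k) (period_mat k f A)"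
  proof (rule image_subsetI)
    fix x assume x: "x \<in> config_fix A \<Lambda>"
    have norm: "cmod (?F x c) = 1" for c using x unfolding config_fix_def by simp
    have nz: "?F x c \<noteq> 0" for c using norm[of c] by (metis norm_zero zero_neq_one)
    have "(\<Prod>c<m * k. ?F x c powi (period_mat k f A $$ (r, c))) = 1" if r: "r < m * k" for r
    proof -
      have "(\<Prod>c<m * k. ?F x c powi (period_mat k f A $$ (r, c))) =
        (\<Prod>i\<in>UNIV. char_val (\<lambda>n. ?F x (cls (rep (r div k) + n) * k + ?g i)) (A $ i $ f (r mod k)))"
        by (rule period_mat_row[OF f r nz])
      also have "\<dots> = (\<Prod>i\<in>UNIV. char_val (\<lambda>n. x (n + rep (r div k)) i) (A $ i $ f (r mod k)))"
        unfolding FG[OF x] by (simp only: add.commute)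
      also have "\<dots> = 1" using x unfolding config_fix_def by blast
      finally show ?thesis .
    qed
    then show "?F x \<in> torus_kernel (m * k) (period_mat k f A)"
      unfolding torus_kernel_def using norm by simp
  qed
  show "?G ` torus_kernel (m * k) (period_mat k f A) \<subseteq> config_fix A \<Lambda>"
  proof (rule image_subsetI)
    fix t assume "t \<in> torus_kernel (m * k) (period_mat k f A)"
    note t = this[unfolded torus_kernel_def mem_Collect_eq]
    have nz: "t c \<noteq> 0" for c using t by (metis norm_zero zero_neq_one)
    have "cls (n + l) = cls n" if "l \<in> \<Lambda>" for n l using that by (simp add: cls_eq_iff)
    moreover have "(\<Prod>i\<in>UNIV. char_val (\<lambda>l. ?G t (l + n) i) (A $ i $ j)) = 1" for n j
    proof -
      let ?r = "cls n * k + ?g j"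
      have "cls (rep (cls n) + l) = cls (l + n)" for l
        using cls_add_cong[of "rep (cls n)" n l] by (simp add: cls_rep cls_less add.commute)
      then have "(\<Prod>i\<in>UNIV. char_val (\<lambda>l. ?G t (l + n) i) (A $ i $ j)) =
          (\<Prod>c<m * k. t c powi (period_mat k f A $$ (?r, c)))"
        unfolding period_mat_row[OF f bound nz] dm g by simp
      then show ?thesis using t bound by simp
    qed
    ultimately show "?G t \<in> config_fix A \<Lambda>" unfolding config_fix_def using t by simp
  qed
qed

lemma index_mat_mult_sum:
  assumes "B \<in> carrier_mat N N" "C \<in> carrier_mat N N" "r < N" "c < N"
  shows "(B * C) $$ (r, c) = (\<Sum>l<N. B $$ (r, l) * C $$ (l, c))"
  using assms by (simp add: scalar_prod_def atLeast0LessThan)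

text \<open>
  With \<open>V\<close> the Fourier matrix, whose entry at \<open>(a, j), (z, i)\<close> is \<open>z\<^sup>n\<close> for \<open>i = j\<close> and \<open>0\<close> otherwise
  (\<open>n\<close> the representative of the coset \<open>a\<close>),
  and \<open>D\<close> the block diagonal matrix of the transposes of the \<open>A(z)\<close>, one has \<open>B V = V D\<close>. By
  orthogonality \<open>V\<close> is invertible, so \<open>det B = det D\<close>.
\<close>

lemma det_period_mat:
  fixes A :: "'d laurent ^ 'k ^ 'k"
  assumes f: "bij_betw f {0..<k} (UNIV :: 'k::finite set)"
  shows "of_int (Determinant.det (period_mat k f A)) = (\<Prod>z\<in>annihilator \<Lambda>. laurent_val (Determinants.det A) z)"
proof -
  let ?N = "m * k"
  have k: "k > 0" using bij_betw_same_card[OF f] by simp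
  obtain \<zeta> where \<zeta>: "bij_betw \<zeta> {0..<m} (annihilator \<Lambda>)"
    using ex_bij_betw_nat_finite[OF finite_annihilator] unfolding card_annihilator by blast
  have \<zeta>m: "\<zeta> b \<in> annihilator \<Lambda>" if "b < m" for b using bij_betwE[OF \<zeta>] that by auto
  have \<zeta>i: "\<zeta> b = \<zeta> b' \<longleftrightarrow> b = b'" if "b < m" "b' < m" for b b'
    using bij_betw_imp_inj_on[OF \<zeta>] that by (auto simp: inj_on_def)
  have fi: "f a = f b \<longleftrightarrow> a = b" if "a < k" "b < k" for a b
    using bij_betw_imp_inj_on[OF f] that by (auto simp: inj_on_def)
  have dv: "r div k < m" if "r < ?N" for r using that by (simp add: less_mult_imp_div_less)
  define L where "L b = (\<lambda>a a'. laurent_val (A $ f a' $ f a) (\<zeta> b))" for b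
  define B :: "complex mat" where "B = map_mat of_int (period_mat k f A)"
  define V where "V = mat ?N ?N (\<lambda>(r, c). if f (r mod k) = f (c mod k) then monom_val (\<zeta> (c div k)) (rep (r div k)) else 0)"
  define U where "U = mat ?N ?N (\<lambda>(r, c). if f (r mod k) = f (c mod k) then inverse (monom_val (\<zeta> (r div k)) (rep (c div k))) else 0)"
  define D where "D = mat ?N ?N (\<lambda>(r, c). if r div k = c div k then L (r div k) (r mod k) (c mod k) else 0)"
  have carr: "B \<in> carrier_mat ?N ?N" "V \<in> carrier_mat ?N ?N" "U \<in> carrier_mat ?N ?N" "D \<in> carrier_mat ?N ?N"
    by (simp_all add: B_def V_def U_def D_def period_mat_def)
  \<comment> \<open>Up to the factor m, U is the inverse of V: the orthogonality relations.\<close>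
  have UV: "U * V = of_nat m \<cdot>\<^sub>m 1\<^sub>m ?N"
  proof (rule eq_matI)
    fix r c assume "r < dim_row (of_nat m \<cdot>\<^sub>m 1\<^sub>m ?N :: complex mat)" "c < dim_col (of_nat m \<cdot>\<^sub>m 1\<^sub>m ?N :: complex mat)"
    then have rc: "r < ?N" "c < ?N" by simp_all
    let ?z = "\<zeta> (r div k)" and ?w = "\<zeta> (c div k)" and ?i = "f (r mod k)" and ?j = "f (c mod k)"
    have "(U * V) $$ (r, c) = (\<Sum>l<?N. U $$ (r, l) * V $$ (l, c))"
      by (rule index_mat_mult_sum[OF carr(3,2) rc])
    also have "\<dots> = (\<Sum>l<?N. (\<lambda>a i. (if ?i = i then inverse (monom_val ?z (rep a)) else 0) *
         (if i = ?j then monom_val ?w (rep a) else 0)) (l div k) (f (l mod k)))"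
      by (rule sum.cong) (use rc in \<open>auto simp: U_def V_def\<close>)
    also have "\<dots> = (\<Sum>a<m. \<Sum>i\<in>UNIV. (if ?i = i then inverse (monom_val ?z (rep a)) else 0) *
         (if i = ?j then monom_val ?w (rep a) else 0))"
      by (rule sum_div_mod[OF f])
    also have "\<dots> = (\<Sum>a<m. if ?i = ?j then inverse (monom_val ?z (rep a)) * monom_val ?w (rep a) else 0)"
      by (rule sum.cong[OF refl]) (simp add: if_distrib[of "\<lambda>x. x * _"] if_distrib[of "\<lambda>x. _ * x"] cong: if_cong)
    also have "\<dots> = (if ?i = ?j then if ?z = ?w then of_nat m else 0 else 0)"
      using annihilator_orthogonal[OF \<zeta>m \<zeta>m, OF dv[OF rc(1)] dv[OF rc(2)]] by simp
    also have "\<dots> = (if r = c then of_nat m else 0)"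
    proof -
      have "?i = ?j \<and> ?z = ?w \<longleftrightarrow> r = c"
        using fi[of "r mod k" "c mod k"] \<zeta>i[OF dv[OF rc(1)] dv[OF rc(2)]] k by (metis div_mult_mod_eq mod_less_divisor)
      then show ?thesis by auto
    qed
    finally show "(U * V) $$ (r, c) = (of_nat m \<cdot>\<^sub>m 1\<^sub>m ?N) $$ (r, c)" using rc by simp
  qed (use carr in auto)
  have "Determinant.det U * Determinant.det V = of_nat m ^ ?N"
    using det_mult[OF carr(3,2)] unfolding UV by simp
  then have detV: "Determinant.det V \<noteq> 0" using m_pos by auto
  have "B * V = V * D"
  proof (rule eq_matI)
    fix r c assume "r < dim_row (V * D)" "c < dim_col (V * D)"
    then have rc: "r < ?N" "c < ?N" using carr by simp_all
    let ?a = "rep (r div k)" and ?z = "\<zeta> (c div k)" and ?j = "f (r mod k)" and ?i = "f (c mod k)"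
    let ?p = "A $ ?i $ ?j"
    have z: "?z \<in> annihilator \<Lambda>" by (rule \<zeta>m[OF dv[OF rc(2)]])
    have "(B * V) $$ (r, c) = (\<Sum>l<?N. B $$ (r, l) * V $$ (l, c))"
      by (rule index_mat_mult_sum[OF carr(1,2) rc])
    also have "\<dots> = (\<Sum>l<?N. (\<lambda>b i. of_int (\<Sum>n\<in>Poly_Mapping.keys (A $ i $ ?j).
         if cls (?a + n) = b then Poly_Mapping.lookup (A $ i $ ?j) n else 0) *
         (if i = ?i then monom_val ?z (rep b) else 0)) (l div k) (f (l mod k)))"
      by (rule sum.cong) (use rc in \<open>auto simp: B_def V_def period_mat_def\<close>)
    also have "\<dots> = (\<Sum>b<m. \<Sum>i\<in>UNIV. of_int (\<Sum>n\<in>Poly_Mapping.keys (A $ i $ ?j).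
         if cls (?a + n) = b then Poly_Mapping.lookup (A $ i $ ?j) n else 0) *
         (if i = ?i then monom_val ?z (rep b) else 0))"
      by (rule sum_div_mod[OF f])
    also have "\<dots> = (\<Sum>b<m. of_int (\<Sum>n\<in>Poly_Mapping.keys ?p.
         if cls (?a + n) = b then Poly_Mapping.lookup ?p n else 0) * monom_val ?z (rep b))"
      by (rule sum.cong[OF refl]) (simp add: if_distrib[of "\<lambda>x. _ * x"] cong: if_cong)
    also have "\<dots> = (\<Sum>b<m. \<Sum>n\<in>Poly_Mapping.keys ?p.
         if cls (?a + n) = b then of_int (Poly_Mapping.lookup ?p n) * monom_val ?z (rep b) else 0)"
      unfolding of_int_sum sum_distrib_right by (intro sum.cong refl) simp
    also have "\<dots> = (\<Sum>n\<in>Poly_Mapping.keys ?p. \<Sum>b<m.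
         if cls (?a + n) = b then of_int (Poly_Mapping.lookup ?p n) * monom_val ?z (rep b) else 0)"
      by (rule sum.swap)
    also have "\<dots> = (\<Sum>n\<in>Poly_Mapping.keys ?p. of_int (Poly_Mapping.lookup ?p n) * monom_val ?z (?a + n))"
    proof (rule sum.cong[OF refl])
      fix n
      have "monom_val ?z (rep (cls (?a + n))) = monom_val ?z (?a + n)"
        by (rule monom_val_cong[OF z]) (simp add: cls_rep cls_less)
      then show "(\<Sum>b<m. if cls (?a + n) = b then of_int (Poly_Mapping.lookup ?p n) * monom_val ?z (rep b) else 0) =
          of_int (Poly_Mapping.lookup ?p n) * monom_val ?z (?a + n)"
        using cls_less by simp
    qed
    also have "\<dots> = monom_val ?z ?a * laurent_val ?p ?z"
      unfolding laurent_val_def sum_distrib_left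
      by (rule sum.cong[OF refl]) (simp add: monom_val_add[OF annihilator_norm[OF z]])
    finally have BV: "(B * V) $$ (r, c) = monom_val ?z ?a * laurent_val ?p ?z" .
    have "(V * D) $$ (r, c) = (\<Sum>l<?N. V $$ (r, l) * D $$ (l, c))"
      by (rule index_mat_mult_sum[OF carr(2,4) rc])
    also have "\<dots> = (\<Sum>l<?N. (\<lambda>b i. (if ?j = i then monom_val (\<zeta> b) ?a else 0) *
         (if b = c div k then laurent_val (A $ ?i $ i) (\<zeta> b) else 0)) (l div k) (f (l mod k)))"
      by (rule sum.cong) (use rc in \<open>auto simp: V_def D_def L_def\<close>)
    also have "\<dots> = (\<Sum>b<m. \<Sum>i\<in>UNIV. (if ?j = i then monom_val (\<zeta> b) ?a else 0) *
         (if b = c div k then laurent_val (A $ ?i $ i) (\<zeta> b) else 0))"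
      by (rule sum_div_mod[OF f])
    also have "\<dots> = (\<Sum>b<m. if b = c div k then monom_val (\<zeta> b) ?a * laurent_val ?p (\<zeta> b) else 0)"
      by (rule sum.cong[OF refl]) (simp add: if_distrib[of "\<lambda>x. x * _"] cong: if_cong)
    also have "\<dots> = monom_val ?z ?a * laurent_val ?p ?z" using dv[OF rc(2)] by simp
    finally show "(B * V) $$ (r, c) = (V * D) $$ (r, c)" using BV by simp
  qed (use carr in auto)
  then have "Determinant.det B * Determinant.det V = Determinant.det V * Determinant.det D"
    using det_mult[OF carr(1,2)] det_mult[OF carr(2,4)] by metis
  then have "Determinant.det B = Determinant.det D" using detV by simp
  moreover have "Determinant.det B = of_int (Determinant.det (period_mat k f A))"
    unfolding B_def by (rule of_int_hom.hom_det)
  moreover have "Determinant.det D = (\<Prod>b<m. Determinant.det (mat k k (\<lambda>(i, j). L b i j)))"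
    unfolding D_def by (rule det_block_diagonal[OF k])
  moreover have "Determinant.det (mat k k (\<lambda>(i, j). L b i j)) = laurent_val (Determinants.det A) (\<zeta> b)" if "b < m" for b
  proof -
    let ?M = "\<chi> i j. laurent_val (A $ i $ j) (\<zeta> b)"
    \<comment> \<open>The blocks of D are the transposes of A(z).\<close>
    have "laurent_val (Determinants.det A) (\<zeta> b) = Determinants.det (Finite_Cartesian_Product.transpose ?M)"
      by (simp add: laurent_val_det annihilator_norm[OF \<zeta>m[OF that]] Determinants.det_transpose)
    also have "\<dots> = Determinant.det (mat k k (\<lambda>(a, b). Finite_Cartesian_Product.transpose ?M $ f a $ f b))"
      by (rule det_eq_det_mat[OF f])
    finally show ?thesis by (simp add: L_def Finite_Cartesian_Product.transpose_def)
  qed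
  moreover have "(\<Prod>b<m. laurent_val (Determinants.det A) (\<zeta> b)) = (\<Prod>z\<in>annihilator \<Lambda>. laurent_val (Determinants.det A) z)"
    using prod.reindex_bij_betw[OF \<zeta>] by (simp add: atLeast0LessThan)
  ultimately show ?thesis by simp
qed

end

theorem lemma5p2:
  fixes A :: "('d::finite laurent) ^ 'k ^ 'k"
    and \<Lambda> :: "(int ^ 'd) set"
  assumes "mat_rank A = CARD('k)"
    and "full_lattice \<Lambda>"
  shows "let M = cokernel_module A;
             F = Fix_points (carrier (dual_space M)) (dual_action M) \<Lambda>;
             P = (\<Prod>z\<in>annihilator \<Lambda>. cmod (laurent_val (det A) z))
         in if P = 0 then infinite F else finite F \<and> real (card F) = P"
proof -
  define F where "F = Fix_points (carrier (dual_space (cokernel_module A))) (dual_action (cokernel_module A)) \<Lambda>"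
  define P where "P = (\<Prod>z\<in>annihilator \<Lambda>. cmod (laurent_val (det A) z))"
  obtain m cls rep where "finite_index \<Lambda> m cls rep" using full_lattice_finite_index[OF assms(2)] .
  then interpret finite_index \<Lambda> m cls rep .
  obtain f where f: "bij_betw f {0..<CARD('k)} (UNIV :: 'k set)"
    using ex_bij_betw_nat_finite[of "UNIV :: 'k set"] by auto
  define B where "B = period_mat CARD('k) f A"
  let ?T = "torus_kernel (m * CARD('k)) B"
  obtain h where h: "bij_betw h F ?T"
    using bij_betw_trans[OF bij_betw_trans[OF bij_betw_Fix_points_lifted_fix bij_betw_lifted_fix_config_fix]
      bij_betw_config_fix_torus_kernel[OF f]]
    unfolding F_def B_def by blast
  have "P = cmod (of_int (Determinant.det B))"
    unfolding P_def B_def det_period_mat[OF f] by (simp add: prod_norm)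
  then have P: "P = \<bar>of_int (Determinant.det B)\<bar>" by simp
  have "if P = 0 then infinite F else finite F \<and> real (card F) = P"
    using card_torus_kernel[OF period_mat_carrier, of "CARD('k)" f A]
    unfolding bij_betw_finite[OF h] bij_betw_same_card[OF h] P B_def[symmetric]
    by (auto split: if_splits)
  then show ?thesis unfolding Let_def F_def P_def .
qed

end
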